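(* Let $\mathcal{E}=\{U(g):g\in G\}$ be a nice error basis for $M_d(\mathbb{C})$ with abelian index group $G$. If an $\mathcal{E}$-nice set of at least $d+1-\sqrt d$ mutually unbiased bases of $\mathbb{C}^d$ can be completed to a set of $d+1$ mutually unbiased bases, then this completion is unique (up to phases of basis vectors and ordering) and every basis in it is $\mathcal{E}$-nice, i.e. each added basis corresponds to a MASA $\mathcal{A}_N$ for some subgroup $N\le G$ of order $d$.
   Context: A nice error basis for $M_d(\mathbb{C})$ with index group $G$ ($|G|=d^2$, identity $e$) is a set $\{U(g):g\in G\}$ of unitaries in $M_d(\mathbb{C})$ with $U(e)=I$, $\mathrm{tr}\,U(g)=0$ for $g\ne e$, and $U(g)U(h)=\lambda(g,h)U(gh)$ for complex phases $\lambda(g,h)$. For a subgroup $H\le G$, $\mathcal{A}_H=\mathrm{span}\{U(h):h\in H\}$. If $H_1,\dots,H_m$ are subgroups of order $d$ with pairwise trivial intersections whose unitaries pairwise commute within each $H_j$, then the $\mathcal{A}_{H_j}$ are pairwise quasi-orthogonal maximal abelian $*$-subalgebras, i.e. each is the algebra of matrices diagonal in some orthonormal basis and these bases are mutually unbiased; such bases are called $\mathcal{E}$-nice MUBs. Two orthonormal bases are mutually unbiased if $|\langle\mathbf{e},\mathbf{f}\rangle|^2=1/d$ for all basis vectors $\mathbf{e},\mathbf{f}$ of the two bases. Bases are identified if they give the same coordinate axes. *)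

theory Defs
  imports "HOL-Analysis.Analysis" "HOL-Algebra.Group"
begin

definition cinner :: "complex^'n \<Rightarrow> complex^'n \<Rightarrow> complex" where
  "cinner v w = (\<Sum>i\<in>UNIV. cnj (v$i) * w$i)"

definition cadjoint :: "complex^'n^'n \<Rightarrow> complex^'n^'n" where
  "cadjoint A = (\<chi> i j. cnj (A$j$i))"

definition cunitary :: "complex^'n^'n \<Rightarrow> bool" where
  "cunitary A \<longleftrightarrow> A ** cadjoint A = mat 1 \<and> cadjoint A ** A = mat 1"

definition csmult :: "complex \<Rightarrow> complex^'n^'n \<Rightarrow> complex^'n^'n" where
  "csmult c A = (\<chi> i j. c * A$i$j)"

definition nice_error_basis :: "('g,'b) monoid_scheme \<Rightarrow> ('g \<Rightarrow> complex^'n^'n) \<Rightarrow> bool" where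
  "nice_error_basis G U \<longleftrightarrow>
     group G \<and> finite (carrier G) \<and> card (carrier G) = CARD('n)^2 \<and>
     (\<forall>g\<in>carrier G. cunitary (U g)) \<and>
     U \<one>\<^bsub>G\<^esub> = mat 1 \<and>
     (\<forall>g\<in>carrier G. g \<noteq> \<one>\<^bsub>G\<^esub> \<longrightarrow> trace (U g) = 0) \<and>
     (\<forall>g\<in>carrier G. \<forall>h\<in>carrier G. \<exists>c. cmod c = 1 \<and> U g ** U h = csmult c (U (g \<otimes>\<^bsub>G\<^esub> h)))"

definition error_alg :: "('g \<Rightarrow> complex^'n^'n) \<Rightarrow> 'g set \<Rightarrow> (complex^'n^'n) set" where
  "error_alg U H = {A. \<exists>c. A = (\<chi> i j. \<Sum>h\<in>H. c h * U h $ i $ j)}"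

definition orthonormal_basis :: "(complex^'n) set \<Rightarrow> bool" where
  "orthonormal_basis B \<longleftrightarrow> card B = CARD('n) \<and>
     (\<forall>e\<in>B. \<forall>f\<in>B. cinner e f = (if e = f then 1 else 0))"

definition mutually_unbiased :: "(complex^'n) set \<Rightarrow> (complex^'n) set \<Rightarrow> bool" where
  "mutually_unbiased B B' \<longleftrightarrow>
     (\<forall>e\<in>B. \<forall>f\<in>B'. (cmod (cinner e f))^2 = 1 / real CARD('n))"

text \<open>The coordinate axes of a basis; bases with the same axes are identified
  (they differ only by phases of basis vectors).\<close>
definition axes :: "(complex^'n) set \<Rightarrow> (complex^'n) set set" where
  "axes B = (\<lambda>e. range (\<lambda>c::complex. c *s e)) ` B"

definition diag_alg :: "(complex^'n) set \<Rightarrow> (complex^'n^'n) set" where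
  "diag_alg B = {A. \<forall>e\<in>B. \<exists>c. A *v e = c *s e}"

definition mub_set :: "(complex^'n) set set \<Rightarrow> bool" where
  "mub_set S \<longleftrightarrow> (\<forall>B\<in>S. orthonormal_basis B) \<and> inj_on axes S \<and>
     (\<forall>B\<in>S. \<forall>B'\<in>S. B \<noteq> B' \<longrightarrow> mutually_unbiased B B')"

definition nice_basis_via :: "('g,'b) monoid_scheme \<Rightarrow> ('g \<Rightarrow> complex^'n^'n) \<Rightarrow> 'g set \<Rightarrow> (complex^'n) set \<Rightarrow> bool" where
  "nice_basis_via G U N B \<longleftrightarrow> subgroup N G \<and> card N = CARD('n) \<and>
     (\<forall>h\<in>N. \<forall>k\<in>N. U h ** U k = U k ** U h) \<and> error_alg U N = diag_alg B"

definition nice_basis :: "('g,'b) monoid_scheme \<Rightarrow> ('g \<Rightarrow> complex^'n^'n) \<Rightarrow> (complex^'n) set \<Rightarrow> bool" where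
  "nice_basis G U B \<longleftrightarrow> (\<exists>N. nice_basis_via G U N B)"

definition nice_mub_set :: "('g,'b) monoid_scheme \<Rightarrow> ('g \<Rightarrow> complex^'n^'n) \<Rightarrow> (complex^'n) set set \<Rightarrow> bool" where
  "nice_mub_set G U S \<longleftrightarrow> mub_set S \<and>
     (\<exists>N. (\<forall>B\<in>S. nice_basis_via G U (N B) B) \<and>
          (\<forall>B\<in>S. \<forall>B'\<in>S. B \<noteq> B' \<longrightarrow> N B \<inter> N B' = {\<one>\<^bsub>G\<^esub>}))"

definition mub_completion :: "(complex^'n) set set \<Rightarrow> (complex^'n) set set \<Rightarrow> bool" where
  "mub_completion S T \<longleftrightarrow> mub_set T \<and> card T = CARD('n) + 1 \<and> axes ` S \<subseteq> axes ` T"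

end

theory Submission
  imports Defs
begin

text \<open>
  Write \<open>d\<close> for the dimension, \<open>k = d + 1 - card S\<close> for the number of added bases and
  \<open>\<kappa> = (k - 1) / d\<close>. A complete set of mutually unbiased bases is a 2-design, so a unit vector \<open>e\<close>
  unbiased to \<open>S\<close> satisfies \<open>\<Sum>c. p c |c\<rangle>\<langle>c| = |e\<rangle>\<langle>e| + \<kappa> I\<close>, where \<open>c\<close> runs over the added vectors
  and \<open>p c = |\<langle>c, e\<rangle>|\<^sup>2\<close>. Cauchy-Schwarz turns this into a gap: \<open>p c = 1\<close> or \<open>p c \<le> \<kappa> (1 + p c)\<close>.
  If the second alternative held for all \<open>c\<close>, then \<open>\<Sum>c. (p c)\<^sup>2 = 1 + \<kappa>\<close> would force
  \<open>1 - \<kappa>\<^sup>2 \<le> k \<kappa>\<close>, which fails for \<open>k\<^sup>2 \<le> d\<close>. Hence the added axes are exactly the axes unbiased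
  to \<open>S\<close>, which gives uniqueness.

  Since \<open>G\<close> is abelian, every \<open>U g\<close> preserves unbiasedness to \<open>S\<close> and so permutes the added axes.
  For \<open>h \<noteq> \<one>\<close> in one of the given subgroups, \<open>U h e\<close> is orthogonal to \<open>e\<close> and therefore stays in the
  same basis; two such subgroups generate \<open>G\<close>. Thus \<open>G\<close> permutes the axes of each added basis, and the
  stabilizer of an axis is the required subgroup.
\<close>

section \<open>Hermitian inner product\<close>

lemma cinner_diff_right: "cinner v (w - z) = cinner v w - cinner v z"
  by (simp add: cinner_def algebra_simps sum_subtractf)

lemma cinner_diff_left: "cinner (v - w) z = cinner v z - cinner w z"
  by (simp add: cinner_def algebra_simps sum_subtractf)

lemma cinner_scale_right: "cinner v (c *s w) = c * cinner v w"
  by (simp add: cinner_def sum_distrib_left algebra_simps)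

lemma cinner_scale_left: "cinner (c *s v) w = cnj c * cinner v w"
  by (simp add: cinner_def sum_distrib_left algebra_simps)

lemma cinner_sum_right: "cinner v (\<Sum>k\<in>K. w k) = (\<Sum>k\<in>K. cinner v (w k))"
  unfolding cinner_def sum_component sum_distrib_left by (rule sum.swap)

lemma cinner_sum_left: "cinner (\<Sum>k\<in>K. w k) v = (\<Sum>k\<in>K. cinner (w k) v)"
  unfolding cinner_def sum_component cnj_sum sum_distrib_right by (rule sum.swap)

lemma cinner_commute: "cnj (cinner v w) = cinner w v"
  by (simp add: cinner_def mult.commute)

lemma cmod_cinner_commute: "cmod (cinner v w) = cmod (cinner w v)"
  by (metis cinner_commute complex_mod_cnj)

lemma cinner_mult_commute: "cinner v w * cinner w v = complex_of_real ((cmod (cinner v w))\<^sup>2)"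
  by (metis cinner_commute complex_norm_square)

lemma cinner_self_eq_0:
  assumes "cinner v v = 0"
  shows "v = 0"
proof -
  have "cinner v v = complex_of_real (\<Sum>i\<in>UNIV. (cmod (v$i))\<^sup>2)"
    unfolding cinner_def of_real_sum complex_norm_square by (simp add: mult.commute)
  then have "(\<Sum>i\<in>UNIV. (cmod (v$i))\<^sup>2) = 0"
    using assms by (metis of_real_eq_0_iff)
  then have "\<forall>i. v$i = 0"
    by (simp add: sum_nonneg_eq_0_iff)
  then show ?thesis
    by (simp add: vec_eq_iff)
qed

lemma cinner_eq_cadjoint: "cinner v (A *v w) = cinner (cadjoint A *v v) w"
proof -
  have "cinner v (A *v w) = (\<Sum>i\<in>UNIV. \<Sum>j\<in>UNIV. cnj (v$i) * (A$i$j * w$j))"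
    by (simp add: cinner_def matrix_vector_mult_def sum_distrib_left)
  also have "\<dots> = (\<Sum>j\<in>UNIV. \<Sum>i\<in>UNIV. cnj (v$i) * (A$i$j * w$j))"
    by (rule sum.swap)
  also have "\<dots> = cinner (cadjoint A *v v) w"
    by (simp add: cinner_def matrix_vector_mult_def cadjoint_def sum_distrib_left sum_distrib_right mult_ac)
  finally show ?thesis .
qed

lemma cinner_cunitary:
  assumes "cunitary A"
  shows "cinner (A *v v) (A *v w) = cinner v w"
  using assms by (simp add: cinner_eq_cadjoint[of "A *v v"] matrix_vector_mul_assoc cunitary_def)

lemma csmult_vector: "csmult c A *v v = c *s (A *v v)"
  by (simp add: vec_eq_iff csmult_def matrix_vector_mult_def sum_distrib_left mult_ac)

lemma matrix_vector_scale: "(A :: complex^'n^'m) *v (c *s v) = c *s (A *v v)"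
  by (simp add: vec_eq_iff matrix_vector_mult_def sum_distrib_left mult_ac)

lemma matrix_vector_sum: "(A :: complex^'n^'m) *v (\<Sum>k\<in>K. w k) = (\<Sum>k\<in>K. A *v w k)"
  by (induction K rule: infinite_finite_induct) (simp_all add: matrix_vector_right_distrib)

text \<open>Equality case of Cauchy-Schwarz: what remains of \<open>e\<close> after projecting onto
  \<open>f\<close> has squared norm \<open>1 - |<f, e>|^2 = 0\<close>.\<close>

lemma unit_parallel:
  assumes e: "cinner e e = 1" and f: "cinner f f = 1" and ef: "cmod (cinner f e) = 1"
  shows "e = cinner f e *s f"
proof -
  have "cinner e f * cinner f e = 1"
    using ef by (simp add: cinner_mult_commute cmod_cinner_commute)
  then have "cinner (e - cinner f e *s f) (e - cinner f e *s f) = 0"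
    by (simp add: cinner_diff_left cinner_diff_right cinner_scale_left cinner_scale_right
        cinner_commute e f algebra_simps)
  then show ?thesis
    using cinner_self_eq_0 by fastforce
qed

section \<open>Completeness of orthonormal families\<close>

text \<open>Orthonormality says that the square matrix with rows \<open>cnj (\<phi> k)\<close> has a
  right inverse, which for square matrices is also a left inverse. The index set is arbitrary so
  that the family can later be indexed by the group.\<close>

lemma orthonormal_family_complete:
  fixes \<phi> :: "'k \<Rightarrow> complex^'i"
  assumes card: "card K = CARD('i)"
    and orth: "\<And>k l. k \<in> K \<Longrightarrow> l \<in> K \<Longrightarrow> cinner (\<phi> k) (\<phi> l) = (if k = l then 1 else 0)"
  shows "(\<Sum>k\<in>K. \<phi> k $ i * cnj (\<phi> k $ j)) = (if i = j then 1 else 0)"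
proof -
  have "finite K"
    using card by (metis card.infinite zero_less_card_finite less_irrefl)
  then obtain \<beta> where \<beta>: "bij_betw \<beta> (UNIV :: 'i set) K"
    using card by (metis finite_same_card_bij finite)
  define M :: "complex^'i^'i" where "M = (\<chi> i j. cnj (\<phi> (\<beta> i) $ j))"
  define M' :: "complex^'i^'i" where "M' = (\<chi> i j. \<phi> (\<beta> j) $ i)"
  have "(M ** M') $ i $ j = (mat 1 :: complex^'i^'i) $ i $ j" for i j
  proof -
    have "\<beta> i \<in> K" "\<beta> j \<in> K" "\<beta> i = \<beta> j \<longleftrightarrow> i = j"
      using \<beta> by (auto simp: bij_betw_def inj_def)
    then show ?thesis
      using orth[of "\<beta> i" "\<beta> j"]
      by (simp add: cinner_def matrix_matrix_mult_def M_def M'_def mat_def)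
  qed
  then have "M ** M' = mat 1"
    by (simp add: vec_eq_iff)
  then have "M' ** M = mat 1"
    by (simp add: matrix_left_right_inverse)
  then have "(M' ** M) $ i $ j = (if i = j then 1 else 0)"
    by (simp add: mat_def)
  then have "(\<Sum>k\<in>UNIV. \<phi> (\<beta> k) $ i * cnj (\<phi> (\<beta> k) $ j)) = (if i = j then 1 else 0)"
    by (simp add: matrix_matrix_mult_def M_def M'_def)
  then show ?thesis
    using sum.reindex_bij_betw[OF \<beta>, of "\<lambda>k. \<phi> k $ i * cnj (\<phi> k $ j)"] by simp
qed

lemma onb_finite:
  assumes "orthonormal_basis (B :: (complex^'n) set)"
  shows "finite B"
  using assms unfolding orthonormal_basis_def
  by (metis card.infinite zero_less_card_finite less_irrefl)

lemma onb_card: "orthonormal_basis (B :: (complex^'n) set) \<Longrightarrow> card B = CARD('n)"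
  by (simp add: orthonormal_basis_def)

lemma onb_unit: "orthonormal_basis B \<Longrightarrow> e \<in> B \<Longrightarrow> cinner e e = 1"
  by (simp add: orthonormal_basis_def)

lemma onb_expand:
  fixes v :: "complex^'n"
  assumes "orthonormal_basis B"
  shows "(\<Sum>c\<in>B. cinner c v *s c) = v"
proof -
  have "(\<Sum>c\<in>B. cinner c v *s c) $ i = v $ i" for i
  proof -
    have "(\<Sum>c\<in>B. cinner c v *s c) $ i = (\<Sum>c\<in>B. \<Sum>j\<in>UNIV. v $ j * (c $ i * cnj (c $ j)))"
      by (simp add: cinner_def sum_distrib_right sum_distrib_left mult_ac)
    also have "\<dots> = (\<Sum>j\<in>UNIV. v $ j * (\<Sum>c\<in>B. c $ i * cnj (c $ j)))"
      unfolding sum_distrib_left by (rule sum.swap)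
    also have "\<dots> = (\<Sum>j\<in>UNIV. v $ j * (if i = j then 1 else 0))"
      using assms orthonormal_family_complete[of B "\<lambda>x. x"]
      by (simp add: orthonormal_basis_def)
    also have "\<dots> = v $ i"
      by (simp add: if_distrib cong: if_cong)
    finally show ?thesis .
  qed
  then show ?thesis
    by (simp add: vec_eq_iff)
qed

lemma onb_parseval:
  assumes "orthonormal_basis B"
  shows "(\<Sum>c\<in>B. cinner x c * cinner c z) = cinner x z"
proof -
  have "cinner x z = cinner x (\<Sum>c\<in>B. cinner c z *s c)"
    by (simp add: onb_expand[OF assms])
  then show ?thesis
    by (simp add: cinner_sum_right cinner_scale_right mult.commute)
qed

lemma onb_parseval_norm:
  assumes "orthonormal_basis B"
  shows "complex_of_real (\<Sum>c\<in>B. (cmod (cinner c v))\<^sup>2) = cinner v v"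
  unfolding onb_parseval[OF assms, of v v, symmetric] cinner_mult_commute
  by (simp add: cmod_cinner_commute)

section \<open>Matrices evaluated in an orthonormal basis\<close>

lemma matrix_eq_on_onb:
  assumes B: "orthonormal_basis B" and eq: "\<And>f. f \<in> B \<Longrightarrow> A *v f = A' *v f"
  shows "A = A'"
proof -
  have "A *v v = A' *v v" for v
  proof -
    have "A *v (\<Sum>c\<in>B. cinner c v *s c) = A' *v (\<Sum>c\<in>B. cinner c v *s c)"
      by (simp add: matrix_vector_sum matrix_vector_scale eq)
    then show ?thesis
      by (simp add: onb_expand[OF B])
  qed
  then show ?thesis
    by (simp add: matrix_eq)
qed

text \<open>Parseval applied row by row: the Hilbert-Schmidt product does not depend on the basis in
  which it is computed.\<close>

lemma hilbert_schmidt_onb: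
  fixes A M :: "complex^'n^'n"
  assumes B: "orthonormal_basis B"
  shows "(\<Sum>f\<in>B. cinner (M *v f) (A *v f)) = (\<Sum>k\<in>UNIV. \<Sum>l\<in>UNIV. cnj (M$k$l) * A$k$l)"
proof -
  have row: "(\<Sum>f\<in>B. cnj ((M *v f)$k) * (A *v f)$k) = (\<Sum>l\<in>UNIV. cnj (M$k$l) * A$k$l)" for k
  proof -
    \<comment> \<open>Conjugating the rows turns the entries of \<open>M *v f\<close> and
      \<open>A *v f\<close> into inner products with fixed vectors.\<close>
    define m a :: "complex^'n" where "m = (\<chi> l. cnj (M$k$l))" and "a = (\<chi> l. cnj (A$k$l))"
    have *: "(M *v f)$k = cinner m f" "(A *v f)$k = cinner a f" for f
      by (simp_all add: m_def a_def cinner_def matrix_vector_mult_def)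
    have "(\<Sum>f\<in>B. cnj ((M *v f)$k) * (A *v f)$k) = (\<Sum>f\<in>B. cinner a f * cinner f m)"
      by (simp add: * cinner_commute mult.commute)
    also have "\<dots> = cinner a m"
      by (rule onb_parseval[OF B])
    finally show ?thesis
      by (simp add: m_def a_def cinner_def mult.commute)
  qed
  show ?thesis
    unfolding cinner_def row[symmetric] by (rule sum.swap)
qed

lemma trace_onb:
  fixes A :: "complex^'n^'n"
  assumes "orthonormal_basis B"
  shows "(\<Sum>f\<in>B. cinner f (A *v f)) = trace A"
proof -
  have "(\<Sum>f\<in>B. cinner f (A *v f)) = (\<Sum>f\<in>B. cinner (mat 1 *v f) (A *v f))"
    by simp
  also have "\<dots> = (\<Sum>k\<in>UNIV. \<Sum>l\<in>UNIV. if k = l then A$k$l else 0)"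
    unfolding hilbert_schmidt_onb[OF assms] by (intro sum.cong) (auto simp: mat_def)
  finally show ?thesis
    by (simp add: trace_def)
qed

section \<open>Complete sets of mutually unbiased bases are 2-designs\<close>

text \<open>Entries of the operator \<open>|x,y><z,w|\<close> on the twofold tensor power, flattened
  to a vector so that \<open>cinner\<close> becomes the Hilbert-Schmidt product. For a unit vector
  \<open>c\<close>, \<open>tens c c c c\<close> is the tensor square of the projection onto
  \<open>c\<close>.\<close>

definition tens :: "complex^'n \<Rightarrow> complex^'n \<Rightarrow> complex^'n \<Rightarrow> complex^'n \<Rightarrow> complex^('n\<times>'n\<times>'n\<times>'n)" where
  "tens x y z w = (\<chi> p. case p of (i, j, k, l) \<Rightarrow> x$i * y$j * cnj (z$k) * cnj (w$l))"

text \<open>Identity plus swap on the twofold tensor power, that is, twice the projection onto the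
  symmetric subspace.\<close>

definition sym_tens :: "complex^('n::finite\<times>'n\<times>'n\<times>'n)" where
  "sym_tens = (\<chi> p. case p of (i, j, k, l) \<Rightarrow>
    of_bool (i = k) * of_bool (j = l) + of_bool (i = l) * of_bool (j = k))"

lemma sum_UNIV_prod4:
  fixes F :: "'n::finite \<times> 'n \<times> 'n \<times> 'n \<Rightarrow> 'a::comm_monoid_add"
  shows "(\<Sum>p\<in>UNIV. F p) = (\<Sum>i\<in>UNIV. \<Sum>j\<in>UNIV. \<Sum>k\<in>UNIV. \<Sum>l\<in>UNIV. F (i, j, k, l))"
  by (simp add: UNIV_Times_UNIV[symmetric] sum.cartesian_product split_def del: UNIV_Times_UNIV)

lemma sum_delta2:
  fixes F :: "'n::finite \<Rightarrow> 'n \<Rightarrow> complex"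
  shows "(\<Sum>k\<in>UNIV. \<Sum>l\<in>UNIV. F k l * (of_bool (i = k) * of_bool (j = l))) = F i j"
proof -
  have "(\<Sum>k\<in>UNIV. \<Sum>l\<in>UNIV. F k l * (of_bool (i = k) * of_bool (j = l)))
      = (\<Sum>k\<in>UNIV. \<Sum>l\<in>UNIV. if j = l then (if i = k then F k l else 0) else 0)"
    by (intro sum.cong) auto
  then show ?thesis
    by simp
qed

lemma sum_prod4:
  fixes a b c d :: "'n::finite \<Rightarrow> complex"
  shows "(\<Sum>i\<in>UNIV. \<Sum>j\<in>UNIV. \<Sum>k\<in>UNIV. \<Sum>l\<in>UNIV. a i * b j * c k * d l)
    = sum a UNIV * sum b UNIV * sum c UNIV * sum d UNIV"
  by (simp add: sum_distrib_left[symmetric] sum_distrib_right[symmetric])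

lemma cinner_tens:
  "cinner (tens x y z w) (tens x' y' z' w') = cinner x x' * cinner y y' * cinner z' z * cinner w' w"
  unfolding cinner_def sum_UNIV_prod4 tens_def sum_prod4[symmetric]
  by (simp add: mult_ac)

lemma cinner_sym_right:
  "cinner \<psi> sym_tens = (\<Sum>i\<in>UNIV. \<Sum>j\<in>UNIV. cnj (\<psi> $ (i, j, i, j)) + cnj (\<psi> $ (i, j, j, i)))"
proof -
  have "cinner \<psi> sym_tens = (\<Sum>i\<in>UNIV. \<Sum>j\<in>UNIV.
      (\<Sum>k\<in>UNIV. \<Sum>l\<in>UNIV. cnj (\<psi> $ (i, j, k, l)) * (of_bool (i = k) * of_bool (j = l))) +
      (\<Sum>l\<in>UNIV. \<Sum>k\<in>UNIV. cnj (\<psi> $ (i, j, k, l)) * (of_bool (i = l) * of_bool (j = k))))"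
    unfolding cinner_def sum_UNIV_prod4 sym_tens_def
    by (subst (2) sum.swap) (simp add: distrib_left sum.distrib)
  then show ?thesis
    by (simp only: sum_delta2)
qed

lemma cinner_tens_sym:
  "cinner (tens x y z w) sym_tens = cinner x z * cinner y w + cinner x w * cinner y z"
proof -
  have "cinner (tens x y z w) sym_tens = (\<Sum>i\<in>UNIV. \<Sum>j\<in>UNIV.
      (cnj (x$i) * z$i) * (cnj (y$j) * w$j) + (cnj (x$i) * w$i) * (cnj (y$j) * z$j))"
    unfolding cinner_sym_right by (intro sum.cong) (simp_all add: tens_def)
  then show ?thesis
    by (simp only: cinner_def sum_product sum.distrib)
qed

lemma cinner_sym_sym:
  "cinner (sym_tens :: complex^('n::finite\<times>'n\<times>'n\<times>'n)) sym_tens = 2 * of_nat (CARD('n) * (CARD('n) + 1))"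
proof -
  have "cinner (sym_tens :: complex^('n::finite\<times>'n\<times>'n\<times>'n)) sym_tens
      = (\<Sum>i\<in>(UNIV :: 'n set). \<Sum>j\<in>(UNIV :: 'n set). 2 + (if i = j then 2 else 0))"
    unfolding cinner_sym_right by (intro sum.cong) (auto simp: sym_tens_def)
  then show ?thesis
    by (simp add: sum.distrib algebra_simps)
qed

text \<open>Each term is \<open>|<c, c'>|^4\<close>. Within one basis only the \<open>d\<close>
  diagonal pairs contribute; across two bases all \<open>d^2\<close> pairs contribute
  \<open>1/d^2\<close>.\<close>

lemma mub_frame_potential:
  fixes T :: "(complex^'n) set set"
  assumes T: "mub_set T" and B: "B \<in> T" and B': "B' \<in> T"
  shows "(\<Sum>c\<in>B. \<Sum>c'\<in>B'. cinner (tens c c c c) (tens c' c' c' c'))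
    = (if B = B' then of_nat CARD('n) else 1)"
proof -
  have tens: "cinner (tens c c c c) (tens c' c' c' c') = complex_of_real (((cmod (cinner c c'))\<^sup>2)\<^sup>2)"
    for c c' :: "complex^'n"
    unfolding cinner_tens power2_eq_square[of "(cmod (cinner c c'))\<^sup>2"] of_real_mult
      cinner_mult_commute[symmetric]
    by (simp add: mult_ac)
  have onb: "orthonormal_basis B" "orthonormal_basis B'"
    using T B B' by (auto simp: mub_set_def)
  note fin = onb_finite[OF onb(1)] and card = onb[THEN onb_card]
  show ?thesis
  proof (cases "B = B'")
    case True
    have "(\<Sum>c\<in>B. \<Sum>c'\<in>B. cinner (tens c c c c) (tens c' c' c' c'))
        = (\<Sum>c\<in>B. \<Sum>c'\<in>B. if c = c' then 1 else 0)"
      unfolding tens using onb by (intro sum.cong) (auto simp: orthonormal_basis_def)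
    then show ?thesis
      using True fin card by simp
  next
    case False
    then have "(cmod (cinner c c'))\<^sup>2 = 1 / real CARD('n)" if "c \<in> B" "c' \<in> B'" for c c'
      using T B B' that unfolding mub_set_def mutually_unbiased_def by blast
    then have "(\<Sum>c\<in>B. \<Sum>c'\<in>B'. cinner (tens c c c c) (tens c' c' c' c'))
        = (\<Sum>c\<in>B. \<Sum>c'\<in>B'. complex_of_real ((1 / real CARD('n))\<^sup>2))"
      unfolding tens by (intro sum.cong) simp_all
    then show ?thesis
      using False card by (simp add: power2_eq_square)
  qed
qed

text \<open>The sum of the \<^term>\<open>tens c c c c\<close> over all basis vectors attains the Welch bound, so its
  distance to \<^term>\<open>sym_tens\<close> vanishes.\<close>
lemma complete_mub_design:
  fixes T :: "(complex^'n) set set"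
  assumes T: "mub_set T" and card_T: "card T = CARD('n) + 1"
  shows "(\<Sum>B\<in>T. \<Sum>c\<in>B. cinner x c * cinner y c * cinner c z * cinner c w)
    = cinner x z * cinner y w + cinner x w * cinner y z"
proof -
  define \<Phi> where "\<Phi> = (\<Sum>B\<in>T. \<Sum>c\<in>B. tens c c c c)"
  define N :: complex where "N = 2 * of_nat (CARD('n) * (CARD('n) + 1))"
  have fin: "finite T"
    using card_T by (metis card.infinite add_is_0 one_neq_zero)
  have onb: "orthonormal_basis B" if "B \<in> T" for B
    using T that by (simp add: mub_set_def)
  have "cinner \<Phi> \<Phi> = (\<Sum>B\<in>T. \<Sum>c\<in>B. \<Sum>B'\<in>T. \<Sum>c'\<in>B'. cinner (tens c c c c) (tens c' c' c' c'))"
    unfolding \<Phi>_def cinner_sum_left by (simp add: cinner_sum_right)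
  also have "\<dots> = (\<Sum>B\<in>T. \<Sum>B'\<in>T. \<Sum>c\<in>B. \<Sum>c'\<in>B'. cinner (tens c c c c) (tens c' c' c' c'))"
    by (intro sum.cong refl sum.swap)
  \<comment> \<open>Every pair of bases counts 1 and every equal pair \<open>d - 1\<close> more, in
    total \<open>(d + 1)^2 + (d + 1) (d - 1) = 2 d (d + 1)\<close>.\<close>
  also have "\<dots> = (\<Sum>B\<in>T. \<Sum>B'\<in>T. 1 + (if B = B' then of_nat CARD('n) - 1 else 0))"
    by (intro sum.cong refl) (simp add: mub_frame_potential[OF T])
  also have "\<dots> = N"
    using fin card_T by (simp add: sum.distrib N_def algebra_simps)
  finally have 1: "cinner \<Phi> \<Phi> = N" .
  have "cinner \<Phi> sym_tens = (\<Sum>B\<in>T. \<Sum>c\<in>B. 2)"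
    unfolding \<Phi>_def cinner_sum_left cinner_tens_sym
    by (intro sum.cong refl) (simp add: onb_unit[OF onb])
  also have "\<dots> = (\<Sum>B\<in>T. 2 * of_nat CARD('n))"
    by (intro sum.cong refl) (simp add: onb_card[OF onb])
  also have "\<dots> = N"
    using card_T by (simp add: N_def algebra_simps)
  finally have 2: "cinner \<Phi> sym_tens = N" .
  then have 3: "cinner sym_tens \<Phi> = N"
    by (metis cinner_commute N_def complex_cnj_of_nat complex_cnj_mult complex_cnj_numeral)
  have "cinner (\<Phi> - sym_tens) (\<Phi> - sym_tens) = 0"
    using cinner_sym_sym[where 'n = 'n]
    by (simp add: cinner_diff_left cinner_diff_right 1 2 3 N_def)
  then have "\<Phi> = sym_tens"
    using cinner_self_eq_0 by fastforce
  then have "cinner (tens x y z w) \<Phi> = cinner x z * cinner y w + cinner x w * cinner y z"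
    by (simp add: cinner_tens_sym)
  then show ?thesis
    by (simp add: \<Phi>_def cinner_sum_right cinner_tens)
qed

section \<open>Vectors unbiased to most bases of a complete set\<close>

lemma onb_prob_sum:
  assumes "orthonormal_basis B" "cinner e e = 1"
  shows "(\<Sum>c\<in>B. (cmod (cinner c e))\<^sup>2) = 1"
  using onb_parseval_norm[OF assms(1), of e] assms(2) by (metis of_real_eq_1_iff)

text \<open>The 2-design identity with \<open>e\<close> in two of its four slots gives the operator
  \<open>I + |e><e|\<close>. Each basis of \<open>S\<close> carries the constant weight
  \<open>1/d\<close> and therefore accounts for \<open>I/d\<close>; moving these to the other side
  leaves the added bases.\<close>

lemma unbiased_weighted_parseval:
  fixes T :: "(complex^'n) set set"
  assumes T: "mub_set T" and card_T: "card T = CARD('n) + 1" and sub: "S \<subseteq> T"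
    and e: "cinner e e = 1"
    and unb: "\<forall>B\<in>S. \<forall>c\<in>B. (cmod (cinner c e))\<^sup>2 = 1 / real CARD('n)"
  shows "(\<Sum>B\<in>T - S. \<Sum>c\<in>B. complex_of_real ((cmod (cinner c e))\<^sup>2) * (cinner x c * cinner c z))
    = complex_of_real ((real (card (T - S)) - 1) / real CARD('n)) * cinner x z + cinner x e * cinner e z"
    (is "?L = _")
proof -
  let ?F = "\<lambda>c. complex_of_real ((cmod (cinner c e))\<^sup>2) * (cinner x c * cinner c z)"
  let ?d = "complex_of_nat CARD('n)"
  have onb: "orthonormal_basis B" if "B \<in> T" for B
    using T that by (simp add: mub_set_def)
  have fin: "finite T"
    using card_T by (metis card.infinite add_is_0 one_neq_zero)
  have 1: "(\<Sum>B\<in>T. \<Sum>c\<in>B. ?F c) = cinner x z + cinner x e * cinner e z"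
  proof -
    have "(\<Sum>B\<in>T. \<Sum>c\<in>B. ?F c)
        = (\<Sum>B\<in>T. \<Sum>c\<in>B. cinner x c * cinner e c * cinner c z * cinner c e)"
      by (simp only: cinner_mult_commute[symmetric] mult_ac)
    also have "\<dots> = cinner x z * cinner e e + cinner x e * cinner e z"
      by (rule complete_mub_design[OF T card_T])
    finally show ?thesis
      by (simp only: e mult_1_right)
  qed
  have 2: "(\<Sum>B\<in>T. \<Sum>c\<in>B. ?F c) = ?L + (\<Sum>B\<in>S. \<Sum>c\<in>B. ?F c)"
    by (rule sum.subset_diff[OF sub fin])
  have 3: "(\<Sum>B\<in>S. \<Sum>c\<in>B. ?F c) = of_nat (card S) / ?d * cinner x z"
  proof -
    have "(\<Sum>c\<in>B. ?F c) = cinner x z / ?d" if "B \<in> S" for B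
    proof -
      have "(\<Sum>c\<in>B. ?F c) = (\<Sum>c\<in>B. cinner x c * cinner c z / ?d)"
        using that unb by (intro sum.cong refl) simp
      then show ?thesis
        using that sub by (simp add: sum_divide_distrib[symmetric] onb_parseval onb subset_iff)
    qed
    then show ?thesis
      by simp
  qed
  have "of_nat (card (T - S)) + complex_of_nat (card S) = ?d + 1"
  proof -
    have "card (T - S) + card S = CARD('n) + 1"
      using card_Diff_subset[of S T] card_mono[OF fin sub] finite_subset[OF sub fin] sub card_T
      by simp
    then show ?thesis
      by (metis of_nat_add of_nat_1)
  qed
  \<comment> \<open>With \<open>k\<close> added bases, \<open>|S| = d + 1 - k\<close>, so what is
    left of the identity operator is \<open>1 - |S|/d = (k - 1)/d\<close>.\<close>
  then have 4: "complex_of_real ((real (card (T - S)) - 1) / real CARD('n)) = 1 - of_nat (card S) / ?d"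
    by (simp add: field_simps)
  show ?thesis
    unfolding 4 left_diff_distrib mult_1_left using 1[unfolded 2 3] by (simp add: algebra_simps)
qed

text \<open>The operator with weights \<open>p c - 1/d\<close> on the added bases other than
  \<open>a\<close> maps \<open>f\<close> to a vector \<open>u\<close> with
  \<open><u, u> = q - q^2\<close>. Pairing with \<open>u\<close> and applying Cauchy-Schwarz gives,
  for \<open>0 < q < 1\<close>, \<open>q - q^2 \<le> \<kappa> (1 - q^2)\<close>, where
  \<open>1 - q\<close> cancels. The second conclusion is the weighted identity evaluated at
  \<open>e\<close>.\<close>

lemma unbiased_overlap_bound:
  fixes T :: "(complex^'n) set set" and e :: "complex^'n"
  defines "p \<equiv> \<lambda>c. (cmod (cinner c e))\<^sup>2"
  assumes T: "mub_set T" and card_T: "card T = CARD('n) + 1" and sub: "S \<subseteq> T"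
    and e: "cinner e e = 1"
    and unb: "\<forall>B\<in>S. \<forall>c\<in>B. p c = 1 / real CARD('n)"
    and a: "a \<in> T - S" and f: "f \<in> a"
    and \<kappa>: "\<kappa> = (real (card (T - S)) - 1) / real CARD('n)"
  shows "p f = 1 \<or> p f \<le> \<kappa> * (1 + p f)"
    and "(\<Sum>B\<in>T - S. \<Sum>c\<in>B. (p c)\<^sup>2) = 1 + \<kappa>"
proof -
  let ?d = "real CARD('n)"
  define q where "q = p f"
  define R where "R = T - S - {a}"
  \<comment> \<open>This is the image of \<open>f\<close> under \<open>|e><e| - q I\<close>.\<close>
  define u where "u = cinner e f *s e - complex_of_real q *s f"
  have onb: "orthonormal_basis B" if "B \<in> T" for B
    using T that by (simp add: mub_set_def)
  have fin: "finite T"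
    using card_T by (metis card.infinite add_is_0 one_neq_zero)
  have f1: "cinner f f = 1"
    using a f onb onb_unit by blast
  have card_R: "real (card R) = \<kappa> * ?d"
    using fin a card_gt_0_iff[of "T - S"] by (auto simp: R_def \<kappa> of_nat_diff Suc_leI)
  then have \<kappa>0: "\<kappa> \<ge> 0"
    by (metis of_nat_0_le_iff of_nat_0_less_iff zero_le_mult_iff zero_less_card_finite not_le)
  have W: "(\<Sum>B\<in>T - S. \<Sum>c\<in>B. complex_of_real (p c) * (cinner x c * cinner c z))
      = complex_of_real \<kappa> * cinner x z + cinner x e * cinner e z" for x z
    unfolding p_def \<kappa> by (rule unbiased_weighted_parseval[OF T card_T sub e unb[unfolded p_def]])
  have "cinner e c * cinner c e = complex_of_real (p c)" for c
    by (simp only: cinner_mult_commute cmod_cinner_commute[of e] p_def)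
  then have "complex_of_real (\<Sum>B\<in>T - S. \<Sum>c\<in>B. (p c)\<^sup>2) = complex_of_real (1 + \<kappa>)"
    using W[of e e] e by (simp add: power2_eq_square)
  then show tot: "(\<Sum>B\<in>T - S. \<Sum>c\<in>B. (p c)\<^sup>2) = 1 + \<kappa>"
    by (simp only: of_real_eq_iff)
  have p1: "(\<Sum>c\<in>B. p c) = 1" if "B \<in> T" for B
    unfolding p_def by (rule onb_prob_sum[OF onb[OF that] e])
  have p01: "0 \<le> p c" for c
    by (simp add: p_def)
  have sa: "q\<^sup>2 \<le> (\<Sum>c\<in>a. (p c)\<^sup>2)" and q1: "q \<le> 1"
  proof -
    have "finite a"
      using a onb onb_finite by blast
    then show "q\<^sup>2 \<le> (\<Sum>c\<in>a. (p c)\<^sup>2)"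
      using f unfolding q_def by (intro member_le_sum) auto
    have "q \<le> (\<Sum>c\<in>a. p c)"
      using f p01 \<open>finite a\<close> unfolding q_def by (intro member_le_sum) auto
    then show "q \<le> 1"
      using p1 a by simp
  qed
  have ef: "cinner e f * cinner f e = of_real q"
    by (simp add: cinner_mult_commute q_def p_def cmod_cinner_commute)
  have uu: "cinner u u = of_real (q - q\<^sup>2)"
  proof -
    have "cinner u u = cinner e f * cinner f e - of_real q * (cinner e f * cinner f e)
        - of_real q * (cinner e f * cinner f e) + of_real q * of_real q"
      by (simp add: u_def cinner_diff_left cinner_diff_right cinner_scale_left cinner_scale_right
          cinner_commute e f1 algebra_simps)
    then show ?thesis
      by (simp add: ef power2_eq_square)
  qed
  \<comment> \<open>With weights \<open>p c\<close>, the bases in \<open>R\<close> send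
    \<open>f\<close> to \<open>\<kappa> f + <e, f> e - q f\<close>, since in \<open>a\<close> only
    \<open>f\<close> itself contributes. With the flat weight \<open>1/d\<close> they send it to
    \<open>\<kappa> f\<close>, and the difference is \<open>u\<close>.\<close>
  have key: "(\<Sum>B\<in>R. \<Sum>c\<in>B. complex_of_real (p c - 1 / ?d) * (cinner u c * cinner c f)) = cinner u u"
  proof -
    have "(\<Sum>B\<in>R. \<Sum>c\<in>B. complex_of_real (p c) * (cinner u c * cinner c f))
        = of_real \<kappa> * cinner u f + cinner u e * cinner e f - of_real q * cinner u f"
    proof -
      have "(\<Sum>c\<in>a. complex_of_real (p c) * (cinner u c * cinner c f))
          = (\<Sum>c\<in>a. if c = f then complex_of_real q * cinner u f else 0)"
        using onb[of a] a f
        by (intro sum.cong refl) (auto simp: orthonormal_basis_def q_def)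
      also have "\<dots> = complex_of_real q * cinner u f"
        using a f onb onb_finite by (subst sum.delta) auto
      finally show ?thesis
        using W[of u f] fin a unfolding R_def by (subst sum_diff1) auto
    qed
    moreover have "(\<Sum>B\<in>R. \<Sum>c\<in>B. complex_of_real (1 / ?d) * (cinner u c * cinner c f))
        = of_real \<kappa> * cinner u f"
    proof -
      have "(\<Sum>c\<in>B. complex_of_real (1 / ?d) * (cinner u c * cinner c f)) = complex_of_real (1 / ?d) * cinner u f"
        if "B \<in> R" for B
        using that by (subst sum_distrib_left[symmetric], subst onb_parseval) (auto simp: R_def onb)
      then have "(\<Sum>B\<in>R. \<Sum>c\<in>B. complex_of_real (1 / ?d) * (cinner u c * cinner c f))
          = complex_of_real (real (card R) / ?d) * cinner u f"
        by simp
      then show ?thesis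
        by (simp add: card_R)
    qed
    moreover have "cinner u u = cinner u e * cinner e f - of_real q * cinner u f"
      by (subst (2) u_def) (simp add: cinner_diff_right cinner_scale_right mult.commute)
    ultimately show ?thesis
      by (simp add: left_diff_distrib sum_subtractf)
  qed
  let ?I = "Sigma R (\<lambda>B. B)"
  have finB: "\<forall>B\<in>R. finite B" and finR: "finite R"
    using onb onb_finite fin by (auto simp: R_def)
  \<comment> \<open>Since \<open>R\<close> omits the basis of \<open>f\<close>, the factors
    \<open>|<c, f>|^2\<close> in the Cauchy-Schwarz estimate are all \<open>1/d\<close>.\<close>
  have unb_f: "(cmod (cinner c f))\<^sup>2 = 1 / ?d" if "B \<in> R" "c \<in> B" for B c
    using T that a f unfolding mub_set_def mutually_unbiased_def R_def by blast
  have "q - q\<^sup>2 = cmod (cinner u u)"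
    using q1 p01[of f] by (simp add: uu power2_eq_square q_def mult_left_le del: of_real_diff)
  also have "\<dots> \<le> (\<Sum>B\<in>R. \<Sum>c\<in>B. cmod (complex_of_real (p c - 1 / ?d) * (cinner u c * cinner c f)))"
    unfolding key[symmetric] by (rule order_trans[OF norm_sum sum_mono[OF norm_sum]])
  also have "\<dots> = (\<Sum>(B, c)\<in>?I. (\<bar>p c - 1 / ?d\<bar> * cmod (cinner c f)) * cmod (cinner c u))"
    unfolding sum.Sigma[OF finR finB]
    by (intro sum.cong refl) (auto simp: norm_mult cmod_cinner_commute[of u] simp del: of_real_diff of_real_divide)
  finally have "(q - q\<^sup>2)\<^sup>2 \<le> (\<Sum>(B, c)\<in>?I. (\<bar>p c - 1 / ?d\<bar> * cmod (cinner c f)) * cmod (cinner c u))\<^sup>2"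
    using q1 p01[of f] by (intro power_mono) (auto simp: power2_eq_square q_def mult_left_le)
  \<comment> \<open>The second factor is Parseval for \<open>u\<close> in each of the
    \<open>\<kappa> d\<close> bases of \<open>R\<close>. The first is a sum of variances, which the
    total \<open>1 + \<kappa>\<close> reduces to \<open>(1 - s)/d\<close> with \<open>s\<close> the
    sum of \<open>(p c)^2\<close> over \<open>a\<close>.\<close>
  also have "\<dots> \<le> (\<Sum>(B, c)\<in>?I. (\<bar>p c - 1 / ?d\<bar> * cmod (cinner c f))\<^sup>2) * (\<Sum>(B, c)\<in>?I. (cmod (cinner c u))\<^sup>2)"
    using Cauchy_Schwarz_ineq_sum[of "\<lambda>(B, c). \<bar>p c - 1 / ?d\<bar> * cmod (cinner c f)" "\<lambda>(B, c). cmod (cinner c u)" ?I]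
    by (simp add: split_def)
  also have "(\<Sum>(B, c)\<in>?I. (cmod (cinner c u))\<^sup>2) = real (card R) * (q - q\<^sup>2)"
  proof -
    have "(\<Sum>c\<in>B. (cmod (cinner c u))\<^sup>2) = q - q\<^sup>2" if "B \<in> R" for B
      using onb_parseval_norm[OF onb[of B], of u] that unfolding uu of_real_eq_iff by (simp add: R_def)
    then show ?thesis
      unfolding sum.Sigma[OF finR finB, symmetric] by simp
  qed
  also have "(\<Sum>(B, c)\<in>?I. (\<bar>p c - 1 / ?d\<bar> * cmod (cinner c f))\<^sup>2) = (1 - (\<Sum>c\<in>a. (p c)\<^sup>2)) / ?d"
  proof -
    have "(\<Sum>c\<in>B. (\<bar>p c - 1 / ?d\<bar> * cmod (cinner c f))\<^sup>2) = ((\<Sum>c\<in>B. (p c)\<^sup>2) - 1 / ?d) / ?d"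
      if B: "B \<in> R" for B
    proof -
      have "(\<Sum>c\<in>B. (\<bar>p c - 1 / ?d\<bar> * cmod (cinner c f))\<^sup>2)
          = (\<Sum>c\<in>B. ((p c)\<^sup>2 - 2 / ?d * p c + 1 / ?d\<^sup>2) / ?d)"
        by (intro sum.cong refl)
          (simp only: power_mult_distrib power2_abs unb_f[OF B], simp add: power2_diff power_divide)
      also have "\<dots> = ((\<Sum>c\<in>B. (p c)\<^sup>2) - 2 / ?d * (\<Sum>c\<in>B. p c) + real (card B) / ?d\<^sup>2) / ?d"
        by (simp add: sum_divide_distrib[symmetric] sum.distrib sum_subtractf sum_distrib_left)
      also have "\<dots> = ((\<Sum>c\<in>B. (p c)\<^sup>2) - 1 / ?d) / ?d"
        using B p1[of B] onb_card[OF onb[of B]] by (simp add: R_def power2_eq_square)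
      finally show ?thesis .
    qed
    then have "(\<Sum>(B, c)\<in>?I. (\<bar>p c - 1 / ?d\<bar> * cmod (cinner c f))\<^sup>2)
        = ((\<Sum>B\<in>R. \<Sum>c\<in>B. (p c)\<^sup>2) - real (card R) / ?d) / ?d"
      unfolding sum.Sigma[OF finR finB, symmetric]
      by (simp add: sum_divide_distrib[symmetric] sum_subtractf)
    also have "(\<Sum>B\<in>R. \<Sum>c\<in>B. (p c)\<^sup>2) = 1 + \<kappa> - (\<Sum>c\<in>a. (p c)\<^sup>2)"
      unfolding R_def using tot fin a by (subst sum_diff1) auto
    finally show ?thesis
      by (simp add: card_R)
  qed
  also have "(1 - (\<Sum>c\<in>a. (p c)\<^sup>2)) / ?d * (real (card R) * (q - q\<^sup>2))
      = \<kappa> * (1 - (\<Sum>c\<in>a. (p c)\<^sup>2)) * (q - q\<^sup>2)"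
    by (simp add: card_R)
  finally have main: "(q - q\<^sup>2)\<^sup>2 \<le> \<kappa> * (1 - (\<Sum>c\<in>a. (p c)\<^sup>2)) * (q - q\<^sup>2)" .
  show "p f = 1 \<or> p f \<le> \<kappa> * (1 + p f)"
  \<comment> \<open>At these two values the common factor \<open>q - q^2\<close> vanishes and cannot
    be cancelled.\<close>
  proof (cases "q = 0 \<or> q = 1")
    case True
    then show ?thesis
      using \<kappa>0 by (auto simp: q_def)
  next
    case False
    then have q: "0 < q" "q < 1"
      using q1 p01[of f] by (auto simp: q_def)
    then have pos: "q - q\<^sup>2 > 0"
      by (simp add: power2_eq_square)
    then have "q - q\<^sup>2 \<le> \<kappa> * (1 - (\<Sum>c\<in>a. (p c)\<^sup>2))"
      using main by (simp add: power2_eq_square)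
    also have "\<dots> \<le> \<kappa> * (1 - q\<^sup>2)"
      using sa \<kappa>0 by (intro mult_left_mono) auto
    finally have "q * (1 - q) \<le> (\<kappa> * (1 + q)) * (1 - q)"
      by (simp add: algebra_simps power2_eq_square)
    then show ?thesis
      using q by (simp add: q_def)
  qed
qed

lemma unbiased_eq_added_vector:
  fixes T :: "(complex^'n) set set"
  assumes T: "mub_set T" and card_T: "card T = CARD('n) + 1" and sub: "S \<subseteq> T"
    and e: "cinner e e = 1"
    and unb: "\<forall>B\<in>S. \<forall>c\<in>B. (cmod (cinner c e))\<^sup>2 = 1 / real CARD('n)"
    and d2: "CARD('n) \<ge> 2" and small: "(card (T - S))\<^sup>2 \<le> CARD('n)"
  shows "\<exists>B\<in>T - S. \<exists>f\<in>B. cmod (cinner f e) = 1"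
proof (rule ccontr)
  assume neg: "\<not> ?thesis"
  let ?d = "real CARD('n)"
  define k where "k = card (T - S)"
  define \<kappa> where "\<kappa> = (real k - 1) / ?d"
  define p where "p = (\<lambda>c. (cmod (cinner c e))\<^sup>2)"
  note bound = unbiased_overlap_bound[OF T card_T sub e unb _ _ \<kappa>_def[unfolded k_def]]
  \<comment> \<open>Without added bases the weighted identity at \<open>e\<close> would read
    \<open>-1/d + 1 = 0\<close>, which fails for \<open>d \<ge> 2\<close>.\<close>
  have k0: "k \<noteq> 0"
  proof
    assume "k = 0"
    moreover have "finite T"
      using card_T by (metis card.infinite add_is_0 one_neq_zero)
    ultimately have "T - S = {}"
      by (simp add: k_def)
    then have "complex_of_real ((0 - 1) / ?d) + 1 = 0"
      using unbiased_weighted_parseval[OF T card_T sub e unb, of e e]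
      by (simp only: e sum.empty card.empty of_nat_0 mult_1_right)
    then have "(0 - 1) / ?d + 1 = 0"
      by (metis of_real_0 of_real_1 of_real_add of_real_eq_iff)
    then show False
      using d2 by (simp add: field_simps)
  qed
  then obtain a where a: "a \<in> T - S"
    by (metis all_not_in_conv card.empty k_def)
  have onb: "orthonormal_basis B" if "B \<in> T" for B
    using T that by (simp add: mub_set_def)
  obtain f where f: "f \<in> a"
    using onb_card[OF onb[of a]] a
    by (metis DiffD1 all_not_in_conv card.empty zero_less_card_finite less_irrefl)
  have tot: "(\<Sum>B\<in>T - S. \<Sum>c\<in>B. (p c)\<^sup>2) = 1 + \<kappa>"
    unfolding p_def by (rule bound(2)[OF a f])
  \<comment> \<open>Multiplying the gap bound by \<open>p c\<close> compares the sum of the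
    \<open>(p c)^2\<close>, known to be \<open>1 + \<kappa>\<close>, with the sum of the
    \<open>p c\<close>, which is 1 on each basis.\<close>
  have le: "(p c)\<^sup>2 * (1 - \<kappa>) \<le> \<kappa> * p c" if "B \<in> T - S" "c \<in> B" for B c
  proof -
    have "p c \<noteq> 1"
      using neg that norm_ge_zero[of "cinner c e"]
      by (auto simp: p_def power2_eq_1_iff simp del: norm_ge_zero)
    then have "p c \<le> \<kappa> * (1 + p c)"
      using bound(1)[OF that] unfolding p_def by blast
    then have "p c * p c \<le> p c * (\<kappa> * (1 + p c))"
      by (intro mult_left_mono) (simp_all add: p_def)
    then show ?thesis
      by (simp add: algebra_simps power2_eq_square)
  qed
  have "(1 + \<kappa>) * (1 - \<kappa>) = (\<Sum>B\<in>T - S. \<Sum>c\<in>B. (p c)\<^sup>2 * (1 - \<kappa>))"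
    by (simp add: tot[symmetric] sum_distrib_right)
  also have "\<dots> \<le> (\<Sum>B\<in>T - S. \<Sum>c\<in>B. \<kappa> * p c)"
    using le by (intro sum_mono) blast
  also have "\<dots> = (\<Sum>B\<in>T - S. \<kappa>)"
    by (intro sum.cong refl) (simp add: sum_distrib_left[symmetric] p_def onb_prob_sum[OF onb e])
  finally have "(1 + \<kappa>) * (1 - \<kappa>) \<le> k * \<kappa>"
    by (simp add: k_def)
  then have "?d\<^sup>2 * ((1 + \<kappa>) * (1 - \<kappa>)) \<le> ?d\<^sup>2 * (k * \<kappa>)"
    by (intro mult_left_mono) auto
  moreover have d\<kappa>: "?d * \<kappa> = real k - 1"
    by (simp add: \<kappa>_def)
  moreover have "?d\<^sup>2 * ((1 + \<kappa>) * (1 - \<kappa>)) = ?d\<^sup>2 - (?d * \<kappa>)\<^sup>2" "?d\<^sup>2 * (k * \<kappa>) = ?d * (k * (?d * \<kappa>))"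
    by (simp_all add: algebra_simps power2_eq_square)
  ultimately have "?d\<^sup>2 - (real k - 1)\<^sup>2 \<le> ?d * (k * (real k - 1))"
    by (simp only: d\<kappa>)
  \<comment> \<open>In this arrangement \<open>k^2 \<le> d\<close> makes the first summand
    nonnegative and the second at least \<open>k^2 > (k - 1)^2\<close>.\<close>
  then have 1: "?d * (?d - (real k)\<^sup>2) + ?d * k \<le> (real k - 1)\<^sup>2"
    by (simp add: algebra_simps power2_eq_square)
  have kd: "(real k)\<^sup>2 \<le> ?d"
    using small unfolding k_def by (metis of_nat_le_iff of_nat_power)
  then have "(real k)\<^sup>2 * 1 \<le> ?d * k"
    using k0 by (intro mult_mono) auto
  moreover have "(real k - 1)\<^sup>2 < (real k)\<^sup>2"
    using k0 by (simp add: power2_eq_square algebra_simps)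
  moreover have "?d * (?d - (real k)\<^sup>2) \<ge> 0"
    using kd by simp
  ultimately show False
    using 1 by linarith
qed

section \<open>Nice error bases\<close>

locale error_basis =
  fixes G :: "('g,'b) monoid_scheme" (structure) and U :: "'g \<Rightarrow> complex^'n^'n"
  assumes nice: "nice_error_basis G U" and comm: "comm_group G"
begin

sublocale comm_group G
  by (rule comm)

lemma fin_G: "finite (carrier G)" and card_G: "card (carrier G) = CARD('n)\<^sup>2"
  using nice by (auto simp: nice_error_basis_def)

lemma U_unitary: "g \<in> carrier G \<Longrightarrow> cunitary (U g)"
  using nice by (simp add: nice_error_basis_def)

lemma U_one: "U \<one> = mat 1"
  using nice by (simp add: nice_error_basis_def)

lemma U_trace: "g \<in> carrier G \<Longrightarrow> g \<noteq> \<one> \<Longrightarrow> trace (U g) = 0"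
  using nice by (simp add: nice_error_basis_def)

lemma cinner_U: "g \<in> carrier G \<Longrightarrow> cinner (U g *v x) (U g *v y) = cinner x y"
  by (simp add: cinner_cunitary U_unitary)

lemma U_mult:
  assumes "g \<in> carrier G" "h \<in> carrier G"
  shows "\<exists>c. cmod c = 1 \<and> (\<forall>v. U g *v (U h *v v) = c *s (U (g \<otimes> h) *v v))"
proof -
  obtain c where "cmod c = 1" "U g ** U h = csmult c (U (g \<otimes> h))"
    using nice assms unfolding nice_error_basis_def by blast
  then show ?thesis
    by (auto simp: matrix_vector_mul_assoc csmult_vector)
qed

text \<open>Commutativity of \<open>G\<close> enters here: both products are phases times the same
  \<open>U (g \<otimes> h)\<close>.\<close>

lemma U_swap:
  assumes g: "g \<in> carrier G" and h: "h \<in> carrier G"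
  shows "\<exists>c. cmod c = 1 \<and> (\<forall>v. U g *v (U h *v v) = c *s (U h *v (U g *v v)))"
proof -
  obtain a where a: "cmod a = 1" "\<forall>v. U g *v (U h *v v) = a *s (U (g \<otimes> h) *v v)"
    using U_mult[OF g h] by blast
  obtain b where b: "cmod b = 1" "\<forall>v. U h *v (U g *v v) = b *s (U (h \<otimes> g) *v v)"
    using U_mult[OF h g] by blast
  have "b \<noteq> 0"
    using b(1) by auto
  then have "\<forall>v. U g *v (U h *v v) = (a / b) *s (U h *v (U g *v v))"
    by (simp add: a b m_comm[OF g h])
  moreover have "cmod (a / b) = 1"
    by (simp add: a b norm_divide)
  ultimately show ?thesis
    by blast
qed

text \<open>Up to a phase, the adjoint of \<open>U g\<close> times \<open>U h\<close> is
  \<open>U (inv g \<otimes> h)\<close>, which is traceless unless \<open>g = h\<close>.\<close>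

lemma hilbert_schmidt_U:
  assumes g: "g \<in> carrier G" and h: "h \<in> carrier G"
  shows "(\<Sum>k\<in>UNIV. \<Sum>l\<in>UNIV. cnj (U g$k$l) * U h$k$l) = (if g = h then of_nat CARD('n) else 0)"
proof -
  define B :: "(complex^'n) set" where "B = range (\<lambda>i. axis i 1)"
  have inj: "inj (\<lambda>i. axis i 1 :: complex^'n)"
    by (auto simp: inj_def axis_eq_axis)
  have B: "orthonormal_basis B"
    unfolding orthonormal_basis_def B_def card_image[OF inj]
    by (auto simp: cinner_def axis_def if_distrib cong: if_cong)
  define k where "k = inv g \<otimes> h"
  have k: "k \<in> carrier G" and gk: "g \<otimes> k = h"
    using g h by (simp_all add: k_def m_assoc[symmetric])
  obtain c where c: "cmod c = 1" "\<forall>v. U g *v (U k *v v) = c *s (U h *v v)"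
    using U_mult[OF g k] unfolding gk by blast
  have "c \<noteq> 0"
    using c(1) by auto
  have "c * (\<Sum>f\<in>B. cinner (U g *v f) (U h *v f)) = (\<Sum>f\<in>B. cinner (U g *v f) (U g *v (U k *v f)))"
    by (simp add: c(2) cinner_scale_right sum_distrib_left)
  also have "\<dots> = trace (U k)"
    unfolding trace_onb[OF B, symmetric] by (simp add: cinner_U[OF g])
  finally have tr: "c * (\<Sum>f\<in>B. cinner (U g *v f) (U h *v f)) = trace (U k)" .
  show ?thesis
  proof (cases "g = h")
    case True
    then show ?thesis
      unfolding hilbert_schmidt_onb[OF B, symmetric] using trace_onb[OF B, of "mat 1"]
      by (simp add: cinner_U[OF h] trace_I)
  next
    case False
    then have "k \<noteq> \<one>"
      using gk g by auto
    then show ?thesis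
      using tr U_trace[OF k] False \<open>c \<noteq> 0\<close> unfolding hilbert_schmidt_onb[OF B] by simp
  qed
qed

text \<open>Divided by the square root of \<open>d\<close>, the \<open>d^2\<close> matrices are an
  orthonormal family in the \<open>d^2\<close>-dimensional matrix space, hence complete.\<close>

lemma U_complete:
  "(\<Sum>g\<in>carrier G. U g$i$j * cnj (U g$k$l)) = (if i = k \<and> j = l then of_nat CARD('n) else 0)"
proof -
  define s :: complex where "s = of_real (sqrt (real CARD('n)))"
  have s: "s * s = of_nat CARD('n)" "s \<noteq> 0" "cnj s = s"
    by (simp_all add: s_def flip: of_real_mult)
  define \<phi> :: "'g \<Rightarrow> complex^('n\<times>'n)" where "\<phi> g = (\<chi> p. U g $ fst p $ snd p / s)" for g
  have "cinner (\<phi> g) (\<phi> h) = (if g = h then 1 else 0)" if "g \<in> carrier G" "h \<in> carrier G" for g h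
  proof -
    have "cinner (\<phi> g) (\<phi> h) = (\<Sum>k\<in>UNIV. \<Sum>l\<in>UNIV. cnj (U g$k$l) * U h$k$l) / (s * s)"
      by (simp add: cinner_def \<phi>_def s sum_divide_distrib sum.cartesian_product split_def)
    then show ?thesis
      using s by (simp add: hilbert_schmidt_U that)
  qed
  then have "(\<Sum>g\<in>carrier G. \<phi> g $ (i, j) * cnj (\<phi> g $ (k, l))) = (if (i, j) = (k, l) then 1 else 0)"
    by (intro orthonormal_family_complete) (simp_all add: card_G power2_eq_square)
  then have "(\<Sum>g\<in>carrier G. U g$i$j * cnj (U g$k$l)) / (s * s) = (if i = k \<and> j = l then 1 else 0)"
    by (simp add: \<phi>_def s sum_divide_distrib)
  then show ?thesis
    using s by (simp add: field_simps split: if_splits)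
qed

text \<open>The overlaps are the Hilbert-Schmidt coefficients of the rank one operator
  \<open>|x><y|\<close>, of norm 1, in a basis whose members have squared norm
  \<open>d\<close>.\<close>

lemma U_parseval:
  assumes x: "cinner x x = 1" and y: "cinner y y = 1"
  shows "(\<Sum>g\<in>carrier G. (cmod (cinner x (U g *v y)))\<^sup>2) = real CARD('n)"
proof -
  have X: "cinner x (U g *v y) = (\<Sum>i\<in>UNIV. \<Sum>j\<in>UNIV. cnj (x$i) * U g$i$j * y$j)" for g
    by (simp add: cinner_def matrix_vector_mult_def sum_distrib_left mult_ac)
  have "complex_of_real (\<Sum>g\<in>carrier G. (cmod (cinner x (U g *v y)))\<^sup>2)
      = (\<Sum>g\<in>carrier G. cinner x (U g *v y) * cnj (cinner x (U g *v y)))"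
    by (simp only: of_real_sum complex_norm_square)
  also have "\<dots> = (\<Sum>g\<in>carrier G. \<Sum>i\<in>UNIV. \<Sum>k\<in>UNIV. \<Sum>j\<in>UNIV. \<Sum>l\<in>UNIV.
      (cnj (x$i) * x$k * y$j * cnj (y$l)) * (U g$i$j * cnj (U g$k$l)))"
    unfolding X cnj_sum sum_product by (simp add: mult_ac)
  also have "\<dots> = (\<Sum>i\<in>UNIV. \<Sum>k\<in>UNIV. \<Sum>j\<in>UNIV. \<Sum>l\<in>UNIV.
      (cnj (x$i) * x$k * y$j * cnj (y$l)) * (\<Sum>g\<in>carrier G. U g$i$j * cnj (U g$k$l)))"
    unfolding sum_distrib_left
    by (subst sum.swap, intro sum.cong refl, subst sum.swap, intro sum.cong refl,
        subst sum.swap, intro sum.cong refl, rule sum.swap)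
  also have "\<dots> = (\<Sum>i\<in>UNIV. \<Sum>k\<in>UNIV. if i = k then \<Sum>j\<in>UNIV. \<Sum>l\<in>UNIV.
      if j = l then of_nat CARD('n) * ((cnj (x$i) * x$i) * (cnj (y$j) * y$j)) else 0 else 0)"
  proof (intro sum.cong refl)
    fix i k
    show "(\<Sum>j\<in>UNIV. \<Sum>l\<in>UNIV. (cnj (x$i) * x$k * y$j * cnj (y$l)) *
          (\<Sum>g\<in>carrier G. U g$i$j * cnj (U g$k$l)))
        = (if i = k then \<Sum>j\<in>UNIV. \<Sum>l\<in>UNIV.
          if j = l then of_nat CARD('n) * ((cnj (x$i) * x$i) * (cnj (y$j) * y$j)) else 0 else 0)"
      by (cases "i = k") (simp_all add: U_complete if_distrib mult_ac cong: if_cong)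
  qed
  also have "\<dots> = of_nat CARD('n) * (\<Sum>i\<in>UNIV. \<Sum>j\<in>UNIV. (cnj (x$i) * x$i) * (cnj (y$j) * y$j))"
    by (simp add: sum_distrib_left)
  also have "\<dots> = of_nat CARD('n) * (cinner x x * cinner y y)"
    unfolding cinner_def sum_product ..
  finally have "complex_of_real (\<Sum>g\<in>carrier G. (cmod (cinner x (U g *v y)))\<^sup>2)
      = complex_of_real (real CARD('n))"
    by (simp only: x y mult_1_right of_real_of_nat_eq)
  then show ?thesis
    by (simp only: of_real_eq_iff)
qed

lemma U_expand:
  "(A :: complex^'n^'n)$i$j = (\<Sum>g\<in>carrier G. (\<Sum>k\<in>UNIV. \<Sum>l\<in>UNIV. cnj (U g$k$l) * A$k$l) / of_nat CARD('n) * U g$i$j)"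
proof -
  have "(\<Sum>g\<in>carrier G. (\<Sum>k\<in>UNIV. \<Sum>l\<in>UNIV. cnj (U g$k$l) * A$k$l) / of_nat CARD('n) * U g$i$j)
      = (\<Sum>g\<in>carrier G. \<Sum>k\<in>UNIV. \<Sum>l\<in>UNIV. A$k$l / of_nat CARD('n) * (U g$i$j * cnj (U g$k$l)))"
    by (simp add: sum_divide_distrib sum_distrib_left sum_distrib_right mult_ac)
  also have "\<dots> = (\<Sum>k\<in>UNIV. \<Sum>l\<in>UNIV. A$k$l / of_nat CARD('n) * (\<Sum>g\<in>carrier G. U g$i$j * cnj (U g$k$l)))"
    unfolding sum_distrib_left
    by (subst sum.swap, intro sum.cong refl, rule sum.swap)
  also have "\<dots> = (\<Sum>k\<in>UNIV. \<Sum>l\<in>UNIV. if j = l then if i = k then A$k$l else 0 else 0)"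
    by (intro sum.cong refl) (simp add: U_complete)
  also have "\<dots> = A$i$j"
    by simp
  finally show ?thesis
    by simp
qed

section \<open>Subgroup algebras and states unbiased to nice bases\<close>

lemma error_alg_memI: "h \<in> N \<Longrightarrow> finite N \<Longrightarrow> U h \<in> error_alg U N"
  unfolding error_alg_def
  by (rule CollectI, rule exI[of _ "\<lambda>n. if n = h then 1 else 0"])
    (simp add: vec_eq_iff if_distrib[of "\<lambda>x. x * _"] cong: if_cong)

lemma error_alg_vector:
  "(\<chi> i j. \<Sum>h\<in>N. c h * U h $ i $ j) *v w = (\<Sum>h\<in>N. c h *s (U h *v w))"
proof -
  have "(\<Sum>j\<in>UNIV. (\<Sum>h\<in>N. c h * U h $ i $ j) * w $ j) = (\<Sum>h\<in>N. c h * (\<Sum>j\<in>UNIV. U h $ i $ j * w $ j))" for i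
    unfolding sum_distrib_left sum_distrib_right by (subst sum.swap) (simp add: mult.assoc)
  then show ?thesis
    by (simp add: vec_eq_iff matrix_vector_mult_def)
qed

text \<open>In a state unbiased to \<open>B\<close> every eigenvector has probability
  \<open>1/d\<close>, so the expectation is the mean of the eigenvalues.\<close>

lemma diag_alg_unbiased_expectation:
  fixes A :: "complex^'n^'n"
  assumes B: "orthonormal_basis B" and A: "A \<in> diag_alg B"
    and unb: "\<forall>c\<in>B. (cmod (cinner c e))\<^sup>2 = 1 / real CARD('n)"
  shows "cinner e (A *v e) = trace A / of_nat CARD('n)"
proof -
  obtain l where l: "\<forall>c\<in>B. A *v c = l c *s c"
    using A bchoice[of B "\<lambda>c l. A *v c = l *s c"] unfolding diag_alg_def by blast
  have "cinner e (A *v e) = cinner e (A *v (\<Sum>c\<in>B. cinner c e *s c))"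
    by (simp add: onb_expand[OF B])
  also have "\<dots> = (\<Sum>c\<in>B. l c * (cinner e c * cinner c e))"
    unfolding matrix_vector_sum matrix_vector_scale cinner_sum_right cinner_scale_right
    by (intro sum.cong refl) (simp add: l cinner_scale_right)
  also have "\<dots> = (\<Sum>c\<in>B. cinner c (A *v c) / of_nat CARD('n))"
  proof (intro sum.cong refl)
    fix c assume c: "c \<in> B"
    then have "cinner e c * cinner c e = 1 / of_nat CARD('n)"
      using unb by (simp add: cinner_mult_commute cmod_cinner_commute[of e] del: of_real_power)
    then show "l c * (cinner e c * cinner c e) = cinner c (A *v c) / of_nat CARD('n)"
      using c by (simp add: l cinner_scale_right onb_unit[OF B])
  qed
  finally show ?thesis
    by (simp add: sum_divide_distrib[symmetric] trace_onb[OF B])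
qed

text \<open>\<open>U h\<close> is traceless and diagonal in \<open>B\<close>. The conclusion will
  keep the translate \<open>U h *v e\<close> of an added vector inside its own basis.\<close>

lemma unbiased_expectation_zero:
  assumes N: "nice_basis_via G U N B" and B: "orthonormal_basis B"
    and unb: "\<forall>c\<in>B. (cmod (cinner c e))\<^sup>2 = 1 / real CARD('n)"
    and h: "h \<in> N" "h \<noteq> \<one>"
  shows "cinner e (U h *v e) = 0"
proof -
  have sub: "N \<subseteq> carrier G"
    using N subgroup.subset unfolding nice_basis_via_def by blast
  then have "finite N"
    using fin_G finite_subset by blast
  then have "U h \<in> diag_alg B"
    using error_alg_memI[OF h(1)] N unfolding nice_basis_via_def by blast
  then show ?thesis
    using diag_alg_unbiased_expectation[OF B _ unb] U_trace[of h] sub h by (simp add: subset_iff)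
qed

text \<open>The projection onto \<open>c \<in> B\<close> is a combination of the \<open>U n\<close> with \<open>n \<in> N\<close>. Its expectation in
  an unbiased state only sees the coefficient of \<open>U \<one>\<close>, and \<open>U g\<close> commutes with each \<open>U n\<close> up to
  a phase.\<close>
lemma unbiased_translate:
  assumes N: "nice_basis_via G U N B" and B: "orthonormal_basis B" and e: "cinner e e = 1"
    and unb: "\<forall>c\<in>B. (cmod (cinner c e))\<^sup>2 = 1 / real CARD('n)" and g: "g \<in> carrier G"
  shows "\<forall>c\<in>B. (cmod (cinner c (U g *v e)))\<^sup>2 = 1 / real CARD('n)"
proof
  fix f assume f: "f \<in> B"
  have N': "subgroup N G" "error_alg U N = diag_alg B"
    using N by (auto simp: nice_basis_via_def)
  then have one: "\<one> \<in> N" and sub: "N \<subseteq> carrier G"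
    by (auto simp: subgroup.one_closed subgroup.subset)
  then have fin: "finite N"
    using fin_G finite_subset by blast
  define P :: "complex^'n^'n" where "P = (\<chi> i j. f$i * cnj (f$j))"
  have P: "P *v v = cinner f v *s f" for v
    by (simp add: P_def vec_eq_iff matrix_vector_mult_def cinner_def sum_distrib_left mult_ac)
  have "P \<in> diag_alg B"
    using f B by (auto simp: diag_alg_def P orthonormal_basis_def intro: exI[of _ 1] exI[of _ 0])
  then obtain c where c: "P = (\<chi> i j. \<Sum>n\<in>N. c n * U n $ i $ j)"
    unfolding N'(2)[symmetric] error_alg_def by blast
  have overlap: "complex_of_real ((cmod (cinner f v))\<^sup>2) = (\<Sum>n\<in>N. c n * cinner v (U n *v v))" for v
  proof -
    have "complex_of_real ((cmod (cinner f v))\<^sup>2) = cinner v (P *v v)"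
      unfolding P cinner_scale_right cinner_mult_commute ..
    then show ?thesis
      unfolding c error_alg_vector by (simp add: cinner_sum_right cinner_scale_right)
  qed
  have only_one: "(\<Sum>n\<in>N. c n * cinner v (U n *v v)) = c \<one>"
    if "\<And>n. n \<in> N \<Longrightarrow> n \<noteq> \<one> \<Longrightarrow> cinner v (U n *v v) = 0" "cinner v v = 1" for v
  proof -
    have "(\<Sum>n\<in>N. c n * cinner v (U n *v v)) = (\<Sum>n\<in>N. if n = \<one> then c \<one> else 0)"
      using that by (intro sum.cong refl) (auto simp: U_one)
    then show ?thesis
      using one fin by simp
  qed
  have zero: "cinner (U g *v e) (U n *v (U g *v e)) = 0" if n: "n \<in> N" "n \<noteq> \<one>" for n
  proof -
    obtain a where "\<forall>v. U n *v (U g *v v) = a *s (U g *v (U n *v v))"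
      using U_swap[of n g] n(1) sub g by blast
    then show ?thesis
      using unbiased_expectation_zero[OF N B unb n] by (simp add: cinner_scale_right cinner_U[OF g])
  qed
  have "complex_of_real ((cmod (cinner f (U g *v e)))\<^sup>2) = c \<one>"
    unfolding overlap by (rule only_one) (simp_all add: zero cinner_U[OF g] e)
  moreover have "complex_of_real ((cmod (cinner f e))\<^sup>2) = c \<one>"
    unfolding overlap by (rule only_one) (simp_all add: unbiased_expectation_zero[OF N B unb] e)
  ultimately have "(cmod (cinner f (U g *v e)))\<^sup>2 = (cmod (cinner f e))\<^sup>2"
    by (metis of_real_eq_iff)
  then show "(cmod (cinner f (U g *v e)))\<^sup>2 = 1 / real CARD('n)"
    using unb f by simp
qed

text \<open>The stabilizer \<open>N\<close> of the axis of \<open>e0\<close> has order \<open>CARD('n)\<close> because the squared overlaps of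
  \<open>e0\<close> with its translates are 0 or 1 and add up to \<open>CARD('n)\<close>; it fixes every axis of \<open>B\<close> because
  \<open>G\<close> permutes the axes transitively and the \<open>U g\<close> commute up to phases.\<close>
lemma nice_of_permuted:
  assumes B: "orthonormal_basis B"
    and H1: "subgroup H1 G" "card H1 = CARD('n)" and H2: "subgroup H2 G" "card H2 = CARD('n)"
    and triv: "H1 \<inter> H2 = {\<one>}"
    and perm: "\<And>h e. h \<in> H1 \<union> H2 \<Longrightarrow> e \<in> B \<Longrightarrow> \<exists>f\<in>B. cmod (cinner f (U h *v e)) = 1"
    and zero: "\<And>h e. h \<in> H1 \<Longrightarrow> h \<noteq> \<one> \<Longrightarrow> e \<in> B \<Longrightarrow> cinner e (U h *v e) = 0"
  shows "nice_basis G U B"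
proof -
  have finB: "finite B" and cardB: "card B = CARD('n)"
    by (rule onb_finite[OF B], rule onb_card[OF B])
  have inner: "cinner e f = (if e = f then 1 else 0)" if "e \<in> B" "f \<in> B" for e f
    using B that by (simp add: orthonormal_basis_def)
  have sub: "H1 \<subseteq> carrier G" "H2 \<subseteq> carrier G"
    using H1 H2 subgroup.subset by blast+
  have perm': "\<exists>f\<in>B. \<exists>c. cmod c = 1 \<and> U h *v e = c *s f" if h: "h \<in> H1 \<union> H2" and e: "e \<in> B" for h e
  proof -
    obtain f where f: "f \<in> B" "cmod (cinner f (U h *v e)) = 1"
      using perm[OF h e] by blast
    have "h \<in> carrier G"
      using h sub by blast
    then have "U h *v e = cinner f (U h *v e) *s f"
      using f e by (intro unit_parallel) (simp_all add: cinner_U inner)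
    then show ?thesis
      using f by blast
  qed
  \<comment> \<open>Trivial intersection makes the \<open>d * d\<close> products distinct, and they
    exhaust the \<open>d^2\<close> elements of \<open>G\<close>.\<close>
  have prod: "\<exists>h1\<in>H1. \<exists>h2\<in>H2. g = h1 \<otimes> h2" if g: "g \<in> carrier G" for g
  proof -
    have "inj_on (\<lambda>(a, b). a \<otimes> b) (H1 \<times> H2)"
    proof (rule inj_onI, clarify)
      fix a b a' b' assume ab: "a \<in> H1" "b \<in> H2" "a' \<in> H1" "b' \<in> H2" and eq: "a \<otimes> b = a' \<otimes> b'"
      then have G: "a \<in> carrier G" "b \<in> carrier G" "a' \<in> carrier G" "b' \<in> carrier G"
        using sub by auto
      have "inv a' \<otimes> a = b' \<otimes> inv b"
      proof -
        have "inv a' \<otimes> a = inv a' \<otimes> (a \<otimes> b) \<otimes> inv b"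
          using G by (simp add: m_assoc)
        also have "\<dots> = b' \<otimes> inv b"
          unfolding eq using G by (simp add: m_assoc[symmetric])
        finally show ?thesis .
      qed
      moreover have "inv a' \<otimes> a \<in> H1" "b' \<otimes> inv b \<in> H2"
        using ab H1 H2 by (auto intro: subgroup.m_closed subgroup.m_inv_closed)
      ultimately have "inv a' \<otimes> a = \<one>"
        using triv by auto
      then have "a = a'"
        using G by (metis inv_equality inv_inv inv_closed)
      then show "a = a' \<and> b = b'"
        using eq G by simp
    qed
    then have "card ((\<lambda>(a, b). a \<otimes> b) ` (H1 \<times> H2)) = card (carrier G)"
      by (simp add: card_image card_cartesian_product H1 H2 card_G power2_eq_square)
    moreover have "(\<lambda>(a, b). a \<otimes> b) ` (H1 \<times> H2) \<subseteq> carrier G"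
      using sub by auto
    ultimately have "(\<lambda>(a, b). a \<otimes> b) ` (H1 \<times> H2) = carrier G"
      using fin_G by (intro card_subset_eq)
    then show ?thesis
      using g by force
  qed
  have perm_all: "\<exists>f\<in>B. \<exists>c. U g *v e = c *s f \<and> cmod c = 1" if g: "g \<in> carrier G" and e: "e \<in> B" for g e
  proof -
    obtain h1 h2 where h: "h1 \<in> H1" "h2 \<in> H2" "g = h1 \<otimes> h2"
      using prod[OF g] by blast
    obtain a where a: "cmod a = 1" "\<forall>v. U h1 *v (U h2 *v v) = a *s (U g *v v)"
      using U_mult[of h1 h2] h sub by blast
    obtain f2 c2 where f2: "f2 \<in> B" "cmod c2 = 1" "U h2 *v e = c2 *s f2"
      using perm'[of h2 e] h e by blast
    obtain f1 c1 where f1: "f1 \<in> B" "cmod c1 = 1" "U h1 *v f2 = c1 *s f1"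
      using perm'[of h1 f2] h f2 by blast
    have "a \<noteq> 0"
      using a(1) by auto
    have "a *s (U g *v e) = (c2 * c1) *s f1"
      using a(2) by (metis f1(3) f2(3) matrix_vector_scale vector_smult_assoc)
    then have "inverse a *s (a *s (U g *v e)) = inverse a *s ((c2 * c1) *s f1)"
      by simp
    then have "U g *v e = (inverse a * (c2 * c1)) *s f1"
      using \<open>a \<noteq> 0\<close> by (simp add: vector_smult_assoc)
    moreover have "cmod (inverse a * (c2 * c1)) = 1"
      by (simp add: norm_mult norm_inverse a f1 f2)
    ultimately show ?thesis
      using f1(1) by blast
  qed
  have "B \<noteq> {}"
    using cardB by auto
  then obtain e0 where e0: "e0 \<in> B"
    by blast
  define F where "F g = cmod (cinner e0 (U g *v e0))" for g
  \<comment> \<open>The translate of \<open>e0\<close> is a phase times a basis vector, so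
    \<open>F g\<close> only records whether \<open>U g\<close> keeps the axis of
    \<open>e0\<close>.\<close>
  have F01: "F g = 0 \<or> F g = 1" if g: "g \<in> carrier G" for g
  proof -
    obtain f c where f: "f \<in> B" "U g *v e0 = c *s f" "cmod c = 1"
      using perm_all[OF g e0] by blast
    then show ?thesis
      by (simp add: F_def cinner_scale_right inner e0 norm_mult)
  qed
  have "\<forall>h\<in>H1. \<exists>f. f \<in> B \<and> (\<exists>c. U h *v e0 = c *s f \<and> cmod c = 1)"
    using perm_all sub e0 by blast
  then obtain t where t: "\<forall>h\<in>H1. t h \<in> B \<and> (\<exists>c. U h *v e0 = c *s t h \<and> cmod c = 1)"
    by (auto dest!: bchoice)
  \<comment> \<open>If \<open>h\<close> and \<open>h'\<close> sent \<open>e0\<close> to the same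
    axis, \<open>U (inv h \<otimes> h')\<close> would keep the axis of \<open>e0\<close>, against
    \<open>zero\<close>. By counting, \<open>H1\<close> then reaches every axis of
    \<open>B\<close>.\<close>
  have "inj_on t H1"
  proof (rule inj_onI, rule ccontr)
    fix h h' assume h: "h \<in> H1" "h' \<in> H1" "t h = t h'" "h \<noteq> h'"
    obtain c c' where c: "U h *v e0 = c *s t h" "cmod c = 1" "U h' *v e0 = c' *s t h" "cmod c' = 1"
      using t h by metis
    define k where "k = inv h \<otimes> h'"
    have G: "h \<in> carrier G" "h' \<in> carrier G"
      using h sub by auto
    have k: "k \<in> H1"
      using h H1 by (auto simp: k_def intro: subgroup.m_closed subgroup.m_inv_closed)
    have hk: "h \<otimes> k = h'"
      using G by (simp add: k_def m_assoc[symmetric])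
    then have "k \<noteq> \<one>"
      using h(4) G by auto
    obtain a where a: "cmod a = 1" "\<forall>v. U h *v (U k *v v) = a *s (U h' *v v)"
      using U_mult[of h k] k G sub hk by blast
    have "a * cinner (U h *v e0) (U h' *v e0) = cinner (U h *v e0) (U h *v (U k *v e0))"
      by (simp add: a(2) cinner_scale_right)
    also have "\<dots> = 0"
      by (simp add: cinner_U G zero[OF k \<open>k \<noteq> \<one>\<close> e0])
    finally have "a * (cnj c * c') = 0"
      using t h by (auto simp: c cinner_scale_left cinner_scale_right inner)
    then show False
      using a(1) c by auto
  qed
  then have t_surj: "t ` H1 = B"
    using t finB by (intro card_subset_eq) (auto simp: card_image H1 cardB)
  \<comment> \<open>Some \<open>U h\<close> with \<open>h \<in> H1\<close> carries \<open>e0\<close>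
    to \<open>f\<close> up to phase and commutes with \<open>U g\<close> up to phase, so the overlap
    is the same at every axis.\<close>
  have same: "cmod (cinner f (U g *v f)) = F g" if f: "f \<in> B" and g: "g \<in> carrier G" for f g
  proof -
    obtain h where h: "h \<in> H1" "f = t h"
      using f t_surj by blast
    obtain c where c: "U h *v e0 = c *s f" "cmod c = 1"
      using t h by blast
    have hG: "h \<in> carrier G"
      using h sub by auto
    obtain a where a: "cmod a = 1" "\<forall>v. U g *v (U h *v v) = a *s (U h *v (U g *v v))"
      using U_swap[OF g hG] by blast
    have "cmod (cinner (U h *v e0) (U g *v (U h *v e0))) = F g"
      by (simp add: a cinner_scale_right norm_mult cinner_U[OF hG] F_def)
    then show ?thesis
      unfolding c(1) by (simp add: matrix_vector_scale cinner_scale_left cinner_scale_right norm_mult c(2))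
  qed
  define N where "N = {g \<in> carrier G. F g = 1}"
  have NG: "N \<subseteq> carrier G" and finN: "finite N"
    using fin_G by (auto simp: N_def)
  have eig: "\<exists>c. U n *v f = c *s f \<and> cmod c = 1" if n: "n \<in> N" and f: "f \<in> B" for n f
  proof -
    have nG: "n \<in> carrier G" and 1: "cmod (cinner f (U n *v f)) = 1"
      using n f same by (auto simp: N_def)
    have "U n *v f = cinner f (U n *v f) *s f"
      by (rule unit_parallel) (simp_all add: cinner_U[OF nG] inner f 1)
    then show ?thesis
      using 1 by blast
  qed
  have "real (card N) = (\<Sum>g\<in>carrier G. if F g = 1 then 1 else 0)"
    unfolding N_def using fin_G by (simp add: sum.If_cases Int_def)
  also have "\<dots> = (\<Sum>g\<in>carrier G. (F g)\<^sup>2)"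
    using F01 by (intro sum.cong refl) auto
  also have "\<dots> = real CARD('n)"
    unfolding F_def using e0 by (intro U_parseval) (simp_all add: inner)
  finally have cardN: "card N = CARD('n)"
    by simp
  have "subgroup N G"
  proof (rule subgroupI[OF NG])
    have "\<one> \<in> N"
      by (simp add: N_def F_def U_one inner e0)
    then show "N \<noteq> {}"
      by blast
  next
    fix g assume g: "g \<in> N"
    then have gG: "g \<in> carrier G" "inv g \<in> carrier G"
      by (auto simp: N_def)
    obtain a where a: "cmod a = 1" "\<forall>v. U (inv g) *v (U g *v v) = a *s (U \<one> *v v)"
      using U_mult[OF gG(2,1)] gG by auto
    obtain l where l: "U g *v e0 = l *s e0" "cmod l = 1"
      using eig[OF g e0] by blast
    have "l * cinner e0 (U (inv g) *v e0) = cinner e0 (U (inv g) *v (U g *v e0))"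
      by (simp add: l matrix_vector_scale cinner_scale_right)
    also have "\<dots> = a"
      by (simp add: a(2) U_one cinner_scale_right inner e0)
    finally have "cmod l * F (inv g) = 1"
      unfolding F_def norm_mult[symmetric] using a by simp
    then show "inv g \<in> N"
      using gG l by (simp add: N_def)
  next
    fix g h assume g: "g \<in> N" and h: "h \<in> N"
    then have G: "g \<in> carrier G" "h \<in> carrier G"
      by (auto simp: N_def)
    obtain a where a: "cmod a = 1" "\<forall>v. U g *v (U h *v v) = a *s (U (g \<otimes> h) *v v)"
      using U_mult[OF G] by blast
    obtain l m where l: "U g *v e0 = l *s e0" "cmod l = 1" and m: "U h *v e0 = m *s e0" "cmod m = 1"
      using eig[OF g e0] eig[OF h e0] by blast
    have "a * cinner e0 (U (g \<otimes> h) *v e0) = cinner e0 (U g *v (U h *v e0))"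
      by (simp add: a(2) cinner_scale_right)
    also have "\<dots> = m * l"
      by (simp add: l m matrix_vector_scale cinner_scale_right inner e0)
    finally have "cmod a * F (g \<otimes> h) = 1"
      unfolding F_def norm_mult[symmetric] using l m by (simp add: norm_mult)
    then show "g \<otimes> h \<in> N"
      using G a by (simp add: N_def)
  qed
  moreover have "U h ** U k = U k ** U h" if h: "h \<in> N" and k: "k \<in> N" for h k
  proof (rule matrix_eq_on_onb[OF B])
    fix f assume f: "f \<in> B"
    obtain l m where "U h *v f = l *s f" "U k *v f = m *s f"
      using eig[OF h f] eig[OF k f] by blast
    then show "U h ** U k *v f = U k ** U h *v f"
      by (simp add: matrix_vector_mul_assoc[symmetric] matrix_vector_scale vector_smult_assoc mult.commute)
  qed
  moreover have "error_alg U N \<subseteq> diag_alg B"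
  proof
    fix A assume "A \<in> error_alg U N"
    then obtain c where c: "A = (\<chi> i j. \<Sum>h\<in>N. c h * U h $ i $ j)"
      unfolding error_alg_def by blast
    have "\<exists>l. A *v f = l *s f" if f: "f \<in> B" for f
    proof -
      obtain l where l: "\<forall>n\<in>N. U n *v f = l n *s f"
        using eig[OF _ f] bchoice[of N "\<lambda>n c. U n *v f = c *s f"] by blast
      have "A *v f = (\<Sum>n\<in>N. c n *s (l n *s f))"
        unfolding c error_alg_vector using l by (intro sum.cong refl) simp
      also have "\<dots> = (\<Sum>n\<in>N. c n * l n) *s f"
        by (simp add: vec.scale_sum_left vector_smult_assoc)
      finally show ?thesis
        by blast
    qed
    then show "A \<in> diag_alg B"
      by (simp add: diag_alg_def)
  qed
  moreover have "diag_alg B \<subseteq> error_alg U N"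
  proof
    fix A assume A: "A \<in> diag_alg B"
    then obtain l where l: "\<forall>f\<in>B. A *v f = l f *s f"
      using bchoice[of B "\<lambda>c l. A *v c = l *s c"] unfolding diag_alg_def by blast
    define s where "s g = (\<Sum>k\<in>UNIV. \<Sum>l\<in>UNIV. cnj (U g$k$l) * A$k$l)" for g
    \<comment> \<open>Outside \<open>N\<close>, \<open>U g\<close> moves every axis of
      \<open>B\<close> to an orthogonal one, so it has no diagonal part and is orthogonal to the
      diagonal matrix \<open>A\<close>. Hence only \<open>N\<close> survives in the expansion of
      \<open>A\<close>.\<close>
    have "s g = 0" if g: "g \<in> carrier G - N" for g
    proof -
      have "cmod (cinner f (U g *v f)) = 0" if f: "f \<in> B" for f
        using same[OF f, of g] F01[of g] g by (auto simp: N_def)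
      then have "cinner (U g *v f) f = 0" if f: "f \<in> B" for f
        using f by (metis cmod_cinner_commute norm_eq_zero)
      then show ?thesis
        unfolding s_def hilbert_schmidt_onb[OF B, symmetric] using l
        by (intro sum.neutral) (simp add: cinner_scale_right)
    qed
    then have "A$i$j = (\<Sum>n\<in>N. s n / of_nat CARD('n) * U n$i$j)" for i j
      unfolding U_expand[of A i j] s_def[symmetric] using fin_G NG
      by (intro sum.mono_neutral_right) auto
    then have "A = (\<chi> i j. \<Sum>n\<in>N. s n / of_nat CARD('n) * U n$i$j)"
      by (simp add: vec_eq_iff)
    then show "A \<in> error_alg U N"
      unfolding error_alg_def by (intro CollectI exI[of _ "\<lambda>n. s n / of_nat CARD('n)"])
  qed
  ultimately show ?thesis
    unfolding nice_basis_def nice_basis_via_def using cardN by blast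
qed

end

section \<open>Completions\<close>

lemma axes_phase:
  assumes eq: "axes B = axes B'" and B: "\<forall>c\<in>B. cinner c c = 1" "\<forall>c\<in>B'. cinner c c = 1" and f: "f \<in> B'"
  shows "\<exists>c\<in>B. \<exists>a. f = a *s c \<and> cmod a = 1"
proof -
  have "range (\<lambda>a. a *s f) \<in> axes B"
    using f unfolding eq by (auto simp: axes_def)
  then obtain c where c: "c \<in> B" "range (\<lambda>a. a *s f) = range (\<lambda>a. a *s c)"
    by (auto simp: axes_def)
  have "1 *s f \<in> range (\<lambda>a. a *s c)"
    unfolding c(2)[symmetric] by (rule rangeI)
  then obtain a where a: "f = a *s c"
    by auto
  then have "cnj a * a = 1"
    using B c(1) f by (metis cinner_scale_left cinner_scale_right mult.assoc mult_1_right)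
  then have "(cmod a)\<^sup>2 = 1"
    by (metis complex_norm_square mult.commute of_real_eq_1_iff)
  then have "cmod a = 1"
    by (simp add: power2_eq_1_iff) (metis norm_ge_zero not_one_le_zero neg_0_le_iff_le)
  then show ?thesis
    using a c(1) by blast
qed

lemma axes_unbiased:
  assumes "axes B = axes B'" "orthonormal_basis B" "orthonormal_basis B'"
    and "\<forall>c\<in>B. (cmod (cinner c e))\<^sup>2 = r"
  shows "\<forall>c\<in>B'. (cmod (cinner c e))\<^sup>2 = r"
proof
  fix f assume f: "f \<in> B'"
  have "\<forall>c\<in>B. cinner c c = 1" "\<forall>c\<in>B'. cinner c c = 1"
    using assms(2,3) onb_unit by blast+
  then obtain c a where "c \<in> B" "f = a *s c" "cmod a = 1"
    using axes_phase[OF assms(1) _ _ f] by blast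
  then show "(cmod (cinner f e))\<^sup>2 = r"
    using assms(4) by (simp add: cinner_scale_left norm_mult)
qed

lemma axes_diag_alg:
  assumes "axes B = axes B'" "orthonormal_basis B" "orthonormal_basis B'"
  shows "diag_alg B \<subseteq> diag_alg B'"
proof
  fix A assume A: "A \<in> diag_alg B"
  have "\<exists>l. A *v f = l *s f" if f: "f \<in> B'" for f
  proof -
    have "\<forall>c\<in>B. cinner c c = 1" "\<forall>c\<in>B'. cinner c c = 1"
      using assms onb_unit by blast+
    then obtain c a where c: "c \<in> B" "f = a *s c"
      using axes_phase[OF assms(1) _ _ f] by blast
    obtain l where "A *v c = l *s c"
      using A c(1) by (auto simp: diag_alg_def)
    then have "A *v f = l *s f"
      by (simp add: c(2) matrix_vector_scale vector_smult_assoc mult.commute)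
    then show ?thesis
      by blast
  qed
  then show "A \<in> diag_alg B'"
    by (simp add: diag_alg_def)
qed

lemma card_axes:
  assumes B: "orthonormal_basis B"
  shows "card (axes B) = card B"
  unfolding axes_def
proof (rule card_image, rule inj_onI, rule ccontr)
  fix e f assume e: "e \<in> B" and f: "f \<in> B" and ne: "e \<noteq> f"
    and eq: "range (\<lambda>c. c *s e) = range (\<lambda>c. c *s f)"
  have "1 *s e \<in> range (\<lambda>c. c *s f)"
    unfolding eq[symmetric] by (rule rangeI)
  then obtain c where "e = c *s f"
    by auto
  then have "cinner e e = c * cinner e f"
    by (metis cinner_scale_right)
  then show False
    using B e f ne by (simp add: orthonormal_basis_def)
qed

text \<open>Only one inclusion has to be checked, since both bases have \<open>d\<close>
  axes.\<close>

lemma axes_eqI: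
  assumes B: "orthonormal_basis B" and B': "orthonormal_basis B'"
    and par: "\<forall>e\<in>B. \<exists>f\<in>B'. cmod (cinner f e) = 1"
  shows "axes B = axes B'"
proof (rule card_subset_eq)
  show "finite (axes B')"
    using onb_finite[OF B'] by (simp add: axes_def)
  show "card (axes B) = card (axes B')"
    by (simp add: card_axes B B' onb_card)
  show "axes B \<subseteq> axes B'"
  proof
    fix L assume "L \<in> axes B"
    then obtain e where e: "e \<in> B" "L = range (\<lambda>c. c *s e)"
      by (auto simp: axes_def)
    obtain f where f: "f \<in> B'" "cmod (cinner f e) = 1"
      using par e by blast
    define a where "a = cinner f e"
    have ef: "e = a *s f"
      unfolding a_def using e f onb_unit B B' by (intro unit_parallel) auto
    have "a \<noteq> 0"
      using f(2) by (auto simp: a_def)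
    have 1: "c *s e = (c * a) *s f" and 2: "c *s f = (c / a) *s e" for c
      using \<open>a \<noteq> 0\<close> by (simp_all add: ef vector_smult_assoc)
    have "L = range (\<lambda>c. c *s f)"
      unfolding e(2)
      by (rule equalityI; rule image_subsetI, rule range_eqI, rule 1 2)
    then show "L \<in> axes B'"
      using f(1) by (auto simp: axes_def)
  qed
qed

text \<open>Vectors of different bases have squared overlap \<open>1/d\<close>, which is not 0.
  Orthogonality thus identifies the basis in which a vector lies.\<close>

lemma mub_set_orthogonal:
  fixes T :: "(complex^'n) set set"
  assumes T: "mub_set T" and BB': "B \<in> T" "B' \<in> T" and ef: "e \<in> B" "f \<in> B'"
    and orth: "cinner e f = 0"
  shows "B = B'"
proof (rule ccontr)
  assume "B \<noteq> B'"
  then have "(cmod (cinner e f))\<^sup>2 = 1 / real CARD('n)"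
    using T BB' ef unfolding mub_set_def mutually_unbiased_def by blast
  then show False
    using orth by simp
qed

text \<open>In dimension 1 every basis has the whole space as its single axis, so injectivity of
  \<open>axes\<close> on \<open>T\<close> leaves room for one basis instead of two.\<close>

lemma completion_dim:
  fixes T :: "(complex^'n) set set"
  assumes T: "mub_set T" and card_T: "card T = CARD('n) + 1"
  shows "CARD('n) \<ge> 2"
proof (rule ccontr)
  assume "\<not> ?thesis"
  then have d1: "CARD('n) = 1"
    using zero_less_card_finite[where 'a = 'n] by linarith
  have "axes B = {UNIV}" if "B \<in> T" for B
  proof -
    have B: "orthonormal_basis B"
      using that T by (simp add: mub_set_def)
    then obtain b where b: "B = {b}"
      using d1 by (auto simp: orthonormal_basis_def card_1_singleton_iff)
    have "v \<in> range (\<lambda>c. c *s b)" for v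
      using onb_expand[OF B, of v] unfolding b by (auto simp: image_iff) metis
    then show ?thesis
      by (auto simp: axes_def b)
  qed
  then have "axes ` T \<subseteq> {{UNIV}}"
    by (simp add: image_subset_iff)
  then have "card (axes ` T) \<le> 1"
    using card_mono[of "{{UNIV}}" "axes ` T"] by simp
  moreover have "card (axes ` T) = card T"
    using T by (auto simp: mub_set_def card_image)
  ultimately show False
    using card_T d1 by simp
qed

section \<open>Added vectors of a completion\<close>

lemma completion_added_vectors:
  fixes S T :: "(complex^'n) set set"
  assumes S: "mub_set S" and T: "mub_completion S T"
    and many: "real (card S) \<ge> real CARD('n) + 1 - sqrt (real CARD('n))"
  shows "\<lbrakk>B \<in> T; axes B \<notin> axes ` S; e \<in> B; B0 \<in> S\<rbrakk>
      \<Longrightarrow> \<forall>c\<in>B0. (cmod (cinner c e))\<^sup>2 = 1 / real CARD('n)"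
    and "\<lbrakk>cinner e e = 1; \<forall>B0\<in>S. \<forall>c\<in>B0. (cmod (cinner c e))\<^sup>2 = 1 / real CARD('n)\<rbrakk>
      \<Longrightarrow> \<exists>B\<in>T. axes B \<notin> axes ` S \<and> (\<exists>f\<in>B. cmod (cinner f e) = 1)"
proof -
  have TT: "mub_set T" and card_T: "card T = CARD('n) + 1" and sub: "axes ` S \<subseteq> axes ` T"
    using T by (auto simp: mub_completion_def)
  have onb: "orthonormal_basis B" if "B \<in> S \<union> T" for B
    using S TT that by (auto simp: mub_set_def)
  {
    assume B: "B \<in> T" "axes B \<notin> axes ` S" "e \<in> B" and B0: "B0 \<in> S"
    obtain B' where B': "B' \<in> T" "axes B' = axes B0"
      using sub B0 by (metis image_iff subsetD imageI)
    then have "B' \<noteq> B"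
      using B B0 by auto
    then have "\<forall>c\<in>B'. (cmod (cinner c e))\<^sup>2 = 1 / real CARD('n)"
      using TT B B' unfolding mub_set_def mutually_unbiased_def by blast
    then show "\<forall>c\<in>B0. (cmod (cinner c e))\<^sup>2 = 1 / real CARD('n)"
      using axes_unbiased[OF B'(2)] onb B' B0 by blast
  }
  assume e: "cinner e e = 1" and unb: "\<forall>B0\<in>S. \<forall>c\<in>B0. (cmod (cinner c e))\<^sup>2 = 1 / real CARD('n)"
  \<comment> \<open>\<open>T\<close> contains the bases of \<open>S\<close> only up to phases;
    \<open>S'\<close> collects their representatives in \<open>T\<close>.\<close>
  define S' where "S' = {B \<in> T. axes B \<in> axes ` S}"
  have S'T: "S' \<subseteq> T"
    by (auto simp: S'_def)
  have fin: "finite T"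
    using card_T by (metis card.infinite add_is_0 one_neq_zero)
  have "axes ` {B \<in> T. axes B \<in> X} = axes ` T \<inter> X" for X
    by auto
  then have "axes ` S' = axes ` S"
    using sub by (simp add: S'_def Int_absorb1)
  moreover have "inj_on axes S" "inj_on axes S'"
    using S TT S'T by (auto simp: mub_set_def intro: inj_on_subset)
  ultimately have "card S' = card S"
    by (metis card_image)
  then have "card (T - S') + card S = CARD('n) + 1"
    using card_Diff_subset[OF finite_subset[OF S'T fin] S'T] card_mono[OF fin S'T] card_T by simp
  then have "real (card (T - S')) + real (card S) = real CARD('n) + 1"
    by (metis of_nat_add of_nat_1)
  \<comment> \<open>The number of added bases is \<open>d + 1 - |S|\<close>, and the threshold on
    \<open>|S|\<close> is what bounds its square by \<open>d\<close>.\<close>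
  then have "real (card (T - S')) \<le> sqrt (real CARD('n))"
    using many by linarith
  then have "(real (card (T - S')))\<^sup>2 \<le> real CARD('n)"
    by (metis of_nat_0_le_iff power_mono real_sqrt_pow2)
  then have small: "(card (T - S'))\<^sup>2 \<le> CARD('n)"
    by (metis of_nat_le_iff of_nat_power)
  have "\<forall>B\<in>S'. \<forall>c\<in>B. (cmod (cinner c e))\<^sup>2 = 1 / real CARD('n)"
  proof
    fix B assume "B \<in> S'"
    then obtain B0 where "B0 \<in> S" "axes B0 = axes B" "B \<in> T"
      by (auto simp: S'_def)
    then show "\<forall>c\<in>B. (cmod (cinner c e))\<^sup>2 = 1 / real CARD('n)"
      using axes_unbiased[of B0 B] onb unb by blast
  qed
  then obtain B f where "B \<in> T - S'" "f \<in> B" "cmod (cinner f e) = 1"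
    using unbiased_eq_added_vector[OF TT card_T S'T e _ completion_dim[OF TT card_T] small] by blast
  then show "\<exists>B\<in>T. axes B \<notin> axes ` S \<and> (\<exists>f\<in>B. cmod (cinner f e) = 1)"
    unfolding S'_def by (intro bexI[of _ B] conjI bexI[of _ f]) simp_all
qed

text \<open>Each vector of an added basis \<open>B\<close> of \<open>T\<close> is unbiased to
  \<open>S\<close>, hence lies on an axis of \<open>T'\<close>. As the vectors of \<open>B\<close>
  are mutually orthogonal, all these axes belong to one basis of \<open>T'\<close>.\<close>

lemma completion_axes_subset:
  fixes S T T' :: "(complex^'n) set set"
  assumes S: "mub_set S" and T: "mub_completion S T" and T': "mub_completion S T'"
    and many: "real (card S) \<ge> real CARD('n) + 1 - sqrt (real CARD('n))"
  shows "axes ` T \<subseteq> axes ` T'"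
proof
  fix A assume "A \<in> axes ` T"
  then obtain B where B: "B \<in> T" "A = axes B"
    by blast
  have TT': "mub_set T'" "axes ` S \<subseteq> axes ` T'"
    using T' by (auto simp: mub_completion_def)
  show "A \<in> axes ` T'"
  proof (cases "axes B \<in> axes ` S")
    case True
    then show ?thesis
      using TT' B by blast
  next
    case False
    have onb: "orthonormal_basis B"
      using B T by (auto simp: mub_completion_def mub_set_def)
    have ex: "\<exists>B'\<in>T'. \<exists>f\<in>B'. cmod (cinner f e) = 1" if "e \<in> B" for e
      using completion_added_vectors(2)[OF S T' many onb_unit[OF onb that]]
        completion_added_vectors(1)[OF S T many B(1) False that] by blast
    have "B \<noteq> {}"
      using onb_card[OF onb] by auto
    then obtain e0 where e0: "e0 \<in> B"
      by blast
    then obtain B' f0 where B': "B' \<in> T'" and f0: "f0 \<in> B'" "cmod (cinner f0 e0) = 1"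
      using ex by blast
    have onb': "orthonormal_basis C" if "C \<in> T'" for C
      using TT' that by (simp add: mub_set_def)
    have "\<exists>f\<in>B'. cmod (cinner f e) = 1" if e: "e \<in> B" for e
    proof (cases "e = e0")
      case True
      then show ?thesis
        using f0 by blast
    next
      case False
      obtain B'' f where B'': "B'' \<in> T'" and f: "f \<in> B''" "cmod (cinner f e) = 1"
        using ex[OF e] by blast
      have "e = cinner f e *s f" "e0 = cinner f0 e0 *s f0"
        using e e0 f f0 onb onb' B' B'' onb_unit by (blast intro: unit_parallel)+
      then have "cinner e e0 = cnj (cinner f e) * (cinner f0 e0 * cinner f f0)"
        by (metis cinner_scale_left cinner_scale_right)
      moreover have "cinner e e0 = 0"
        using e e0 onb False by (simp add: orthonormal_basis_def)
      moreover have "cinner f e \<noteq> 0" "cinner f0 e0 \<noteq> 0"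
        using f(2) f0(2) by auto
      ultimately have "cinner f f0 = 0"
        by simp
      then have "B'' = B'"
        using mub_set_orthogonal[OF TT'(1) B'' B' f(1) f0(1)] by blast
      then show ?thesis
        using f by blast
    qed
    then have "axes B = axes B'"
      using axes_eqI[OF onb onb'[OF B']] by blast
    then show ?thesis
      using B B' by blast
  qed
qed

text \<open>A basis with the axes of some member of \<open>S\<close> inherits its subgroup, because
  \<open>diag_alg\<close> depends only on the axes. For a new basis, two of the given subgroups
  supply the hypotheses of \<open>nice_of_permuted\<close>.\<close>

lemma completion_nice:
  fixes G :: "('g,'b) monoid_scheme" and U :: "'g \<Rightarrow> complex^'n^'n"
    and S :: "(complex^'n) set set"
  assumes nice: "nice_error_basis G U" and comm: "comm_group G" and S: "nice_mub_set G U S"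
    and many: "real (card S) \<ge> real CARD('n) + 1 - sqrt (real CARD('n))"
    and T: "mub_completion S T" and B: "B \<in> T"
  shows "nice_basis G U B"
proof -
  interpret error_basis G U
    using nice comm by (rule error_basis.intro)
  obtain N where N: "\<forall>B\<in>S. nice_basis_via G U (N B) B"
    and triv: "\<forall>B\<in>S. \<forall>B'\<in>S. B \<noteq> B' \<longrightarrow> N B \<inter> N B' = {\<one>\<^bsub>G\<^esub>}"
    using S by (auto simp: nice_mub_set_def)
  have SS: "mub_set S" and TT: "mub_set T" and card_T: "card T = CARD('n) + 1"
    using S T by (auto simp: nice_mub_set_def mub_completion_def)
  have onb: "orthonormal_basis C" if "C \<in> S \<union> T" for C
    using SS TT that by (auto simp: mub_set_def)
  show ?thesis
  proof (cases "axes B \<in> axes ` S")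
    case True
    then obtain B0 where B0: "B0 \<in> S" "axes B0 = axes B"
      by auto
    then have "diag_alg B0 = diag_alg B"
      using axes_diag_alg[of B0 B] axes_diag_alg[of B B0] onb B by auto
    then show ?thesis
      using N B0 unfolding nice_basis_def nice_basis_via_def by auto
  next
    case False
    have d2: "CARD('n) \<ge> 2"
      by (rule completion_dim[OF TT card_T])
    \<comment> \<open>This makes the threshold on \<open>|S|\<close> exceed 1, so two different
      bases with their subgroups are available.\<close>
    have "sqrt (real CARD('n)) < real CARD('n)"
      using d2 by (intro real_less_lsqrt) (auto simp: power2_eq_square)
    then have "card S > 1"
      using many by linarith
    then obtain B1 B2 where B12: "B1 \<in> S" "B2 \<in> S" "B1 \<noteq> B2"
      by (metis One_nat_def card_le_Suc0_iff_eq card.infinite not_le less_nat_zero_code)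
    have sg: "subgroup (N B0) G" "card (N B0) = CARD('n)" if "B0 \<in> S" for B0
      using N that by (auto simp: nice_basis_via_def)
    note unb = completion_added_vectors(1)[OF SS T many B False]
    have zero: "cinner e (U h *v e) = 0" if "B0 \<in> S" "h \<in> N B0" "h \<noteq> \<one>\<^bsub>G\<^esub>" "e \<in> B" for B0 h e
      using unbiased_expectation_zero[of "N B0" B0 e h] N onb unb that by blast
    have perm: "\<exists>f\<in>B. cmod (cinner f (U h *v e)) = 1" if B0: "B0 \<in> S" and h: "h \<in> N B0" and e: "e \<in> B" for B0 h e
    \<comment> \<open>The identity fixes \<open>e\<close>; the orthogonality that puts
      \<open>U h *v e\<close> back into \<open>B\<close> holds only for the other elements.\<close>
    proof (cases "h = \<one>\<^bsub>G\<^esub>")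
      case True
      then show ?thesis
        using e onb_unit[OF onb e] B by (intro bexI[of _ e]) (simp_all add: U_one)
    next
      case False
      have hG: "h \<in> carrier G"
        by (rule subgroup.mem_carrier[OF sg(1)[OF B0] h])
      have e1: "cinner e e = 1"
        using onb_unit[OF onb e] B by simp
      have "\<forall>C\<in>S. \<forall>c\<in>C. (cmod (cinner c (U h *v e)))\<^sup>2 = 1 / real CARD('n)"
      proof
        fix C assume C: "C \<in> S"
        show "\<forall>c\<in>C. (cmod (cinner c (U h *v e)))\<^sup>2 = 1 / real CARD('n)"
          using N C onb by (intro unbiased_translate[OF _ _ e1 unb[OF e C] hG]) auto
      qed
      then obtain B' f where B': "B' \<in> T" and f: "f \<in> B'" "cmod (cinner f (U h *v e)) = 1"
        using completion_added_vectors(2)[OF SS T many, of "U h *v e"] e1 cinner_U[OF hG, of e e] by metis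
      have "U h *v e = cinner f (U h *v e) *s f"
        using onb_unit[OF onb f(1)] B' e1 f(2)
        by (intro unit_parallel) (simp_all add: cinner_U[OF hG])
      then have "cinner e (U h *v e) = cinner f (U h *v e) * cinner e f"
        by (metis cinner_scale_right)
      then have "cinner e f = 0"
        using zero[OF B0 h False e] f(2) by (metis mult_eq_0_iff norm_zero zero_neq_one)
      then have "B' = B"
        using mub_set_orthogonal[OF TT B' B f(1) e] cinner_commute[of e f] by simp
      then show ?thesis
        using f by blast
    qed
    show ?thesis
    proof (rule nice_of_permuted[of B "N B1" "N B2"])
      show "orthonormal_basis B"
        using onb B by blast
      show "N B1 \<inter> N B2 = {\<one>\<^bsub>G\<^esub>}"
        using triv B12 by blast
      show "\<And>h e. h \<in> N B1 \<union> N B2 \<Longrightarrow> e \<in> B \<Longrightarrow> \<exists>f\<in>B. cmod (cinner f (U h *v e)) = 1"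
        using perm B12 by blast
      show "\<And>h e. h \<in> N B1 \<Longrightarrow> h \<noteq> \<one>\<^bsub>G\<^esub> \<Longrightarrow> e \<in> B \<Longrightarrow> cinner e (U h *v e) = 0"
        using zero B12 by blast
    qed (use sg B12 in auto)
  qed
qed

theorem mainTheorem11:
  fixes G :: "('g,'b) monoid_scheme" and U :: "'g \<Rightarrow> complex^'n^'n"
    and S :: "(complex^'n) set set"
  assumes "nice_error_basis G U"
    and "comm_group G"
    and "nice_mub_set G U S"
    and "real (card S) \<ge> real CARD('n) + 1 - sqrt (real CARD('n))"
    and "\<exists>T. mub_completion S T"
  shows "(\<forall>T T'. mub_completion S T \<and> mub_completion S T' \<longrightarrow> axes ` T = axes ` T')
     \<and> (\<forall>T. mub_completion S T \<longrightarrow> (\<forall>B\<in>T. nice_basis G U B))"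
proof -
  have "mub_set S"
    using assms(3) by (simp add: nice_mub_set_def)
  then show ?thesis
    using completion_axes_subset assms(4) completion_nice[OF assms(1-4)] by blast
qed

end
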